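(* Every hypergraph in $\mathcal{R}_k$ is weakly thick, and consequently satisfies Sidorenko's conjecture: for $H\in\mathcal{R}_k$, $t(H,G)\ge t(e_k,G)^{|E(H)|}$ for every finite $k$-uniform hypergraph $G$.
   Context: A $k$-uniform hypergraph has a finite vertex set and edges that are $k$-element subsets. A homomorphism $H\to G$ is a map $V(H)\to V(G)$ sending each edge of $H$ onto an edge of $G$; $t(H,G)$ is the probability that a uniformly random map $V(H)\to V(G)$ is a homomorphism; $e_k$ is the single-edge hypergraph $\{1,\dots,k\}$. $b$-hypergraphs: $M=(V,E,B)$ with $V$ finite, $E\subseteq 2^V$, $B\subseteq 2^V\times2^V$ symmetric. For $L\in E$, $X\subseteq L$: $r_{L,X}(M)$ has vertex set $V'$ = disjoint union of $V$ and $L$ with the two copies of each $x\in X$ identified (injections $\tau_1:V\to V'$, $\tau_2:L\to V'$); edges $\tau_1(K)$ ($K\in E$), $\tau_2(K)$ ($K\in E,K\subseteq L$), and $\tau_1(K_1)\cup\tau_2(K_2)$ for all $K_1,K_2\in E$ with $K_2\subseteq L$, $X\subseteq K_1\cap K_2$; relation: $\tau_1$-images of pairs in $B$, $\tau_2$-images of pairs in $B\cap(2^L\times2^L)$, and pairs $(\tau_1(K_1),\tau_2(K_2))$ (and reverses) for such $K_1,K_2$. A $k$-reflection complex is obtained from $(\{1,\dots,k\},\{\{1,\dots,k\}\},\emptyset)$ by finitely many operations $r_{L,X}$; its frame $\mathcal{F}(M)$ is the $k$-uniform hypergraph of its $k$-element edges. $\mathcal{Z}_k$ is the set of $k$-uniform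 hypergraphs whose edges are pairwise disjoint (isolated edges plus isolated vertices). $\mathcal{C}_k$ is the set of $k$-reflection complexes obtainable from the trivial one by operations $M\mapsto r_{L,X}(M)$ in which the subhypergraph of $\mathcal{F}(M)$ spanned by $X$ (vertex set $X$, edges of $\mathcal{F}(M)$ contained in $X$) lies in $\mathcal{Z}_k$. $\mathcal{R}_k$ is the set of frames of members of $\mathcal{C}_k$. Weak thickness: in $\mathbb{R}^{2^V}$, $1_S$ is the indicator of the subset $S$; $t_{A,B}=1_{A\cup B}-1_A-1_B+1_{A\cap B}$; $W_B=\mathrm{span}\{t_{A,B}:(A,B)\in B\}$; $Q_V=\mathbb{R}1_\emptyset+$ the cone of nonnegative combinations of all $t_{A,B}$ and $1_A$. For a hypergraph $H$ on $V$, $s_H(V)=-1_V+\sum_{e\in E(H)}1_e$. A $k$-reflection complex with frame $H$ is weakly thick if $s_H(V)\in W_B+Q_V$; a $k$-uniform hypergraph is weakly thick if it is the frame of a weakly thick $k$-reflection complex. *)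

theory Defs
  imports "HOL-Analysis.Analysis" "HOL-Library.Function_Algebras"
begin

subsection \<open>Hypergraphs and homomorphism densities\<close>

record 'a hypergraph =
  hverts :: "'a set"
  hedges :: "'a set set"

definition k_uniform :: "nat \<Rightarrow> 'a hypergraph \<Rightarrow> bool" where
  "k_uniform k H \<longleftrightarrow> finite (hverts H) \<and> (\<forall>e\<in>hedges H. e \<subseteq> hverts H \<and> card e = k)"

definition single_edge :: "nat \<Rightarrow> nat hypergraph" where
  "single_edge k = \<lparr>hverts = {1..k}, hedges = {{1..k}}\<rparr>"

definition homs :: "'a hypergraph \<Rightarrow> 'b hypergraph \<Rightarrow> ('a \<Rightarrow> 'b) set" where
  "homs H G = {\<phi> \<in> hverts H \<rightarrow>\<^sub>E hverts G. \<forall>e\<in>hedges H. \<phi> ` e \<in> hedges G}"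

text \<open>The probability, under the uniform distribution on all maps between the vertex sets,
  of being a homomorphism.  If there are no maps at all, the quotient is \<open>0 / 0 = 0\<close>.\<close>

definition hom_density :: "'a hypergraph \<Rightarrow> 'b hypergraph \<Rightarrow> real" where
  "hom_density H G = real (card (homs H G)) / real (card (hverts H \<rightarrow>\<^sub>E hverts G))"


subsection \<open>Reflection complexes\<close>

record 'a b_hypergraph =
  bverts :: "'a set"
  bedges :: "'a set set"
  brel :: "('a set \<times> 'a set) set"

definition is_b_hypergraph :: "'a b_hypergraph \<Rightarrow> bool" where
  "is_b_hypergraph M \<longleftrightarrow> finite (bverts M) \<and> bedges M \<subseteq> Pow (bverts M)
     \<and> brel M \<subseteq> Pow (bverts M) \<times> Pow (bverts M) \<and> sym (brel M)"

definition trivial_complex :: "nat \<Rightarrow> nat b_hypergraph" where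
  "trivial_complex k = \<lparr>bverts = {1..k}, bedges = {{1..k}}, brel = {}\<rparr>"

text \<open>\<open>gluing_maps V L X \<tau>\<^sub>1 \<tau>\<^sub>2\<close>: the images of \<open>\<tau>\<^sub>1\<close> and \<open>\<tau>\<^sub>2\<close> together form a copy of
  the disjoint union of \<open>V\<close> and \<open>L\<close> in which exactly the two copies of each \<open>x \<in> X\<close>
  are identified.\<close>

definition gluing_maps :: "'a set \<Rightarrow> 'a set \<Rightarrow> 'a set \<Rightarrow> ('a \<Rightarrow> 'b) \<Rightarrow> ('a \<Rightarrow> 'b) \<Rightarrow> bool" where
  "gluing_maps V L X \<tau>\<^sub>1 \<tau>\<^sub>2 \<longleftrightarrow> inj_on \<tau>\<^sub>1 V \<and> inj_on \<tau>\<^sub>2 L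
     \<and> (\<forall>v\<in>V. \<forall>l\<in>L. \<tau>\<^sub>1 v = \<tau>\<^sub>2 l \<longleftrightarrow> v = l \<and> l \<in> X)"

definition reflection ::
    "('a \<Rightarrow> 'b) \<Rightarrow> ('a \<Rightarrow> 'b) \<Rightarrow> 'a b_hypergraph \<Rightarrow> 'a set \<Rightarrow> 'a set \<Rightarrow> 'b b_hypergraph" where
  "reflection \<tau>\<^sub>1 \<tau>\<^sub>2 M L X =
    \<lparr>bverts = \<tau>\<^sub>1 ` bverts M \<union> \<tau>\<^sub>2 ` L,
     bedges = {\<tau>\<^sub>1 ` K | K. K \<in> bedges M}
       \<union> {\<tau>\<^sub>2 ` K | K. K \<in> bedges M \<and> K \<subseteq> L}
       \<union> {\<tau>\<^sub>1 ` K\<^sub>1 \<union> \<tau>\<^sub>2 ` K\<^sub>2 | K\<^sub>1 K\<^sub>2.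
            K\<^sub>1 \<in> bedges M \<and> K\<^sub>2 \<in> bedges M \<and> K\<^sub>2 \<subseteq> L \<and> X \<subseteq> K\<^sub>1 \<inter> K\<^sub>2},
     brel = {(\<tau>\<^sub>1 ` A, \<tau>\<^sub>1 ` C) | A C. (A, C) \<in> brel M}
       \<union> {(\<tau>\<^sub>2 ` A, \<tau>\<^sub>2 ` C) | A C. (A, C) \<in> brel M \<inter> (Pow L \<times> Pow L)}
       \<union> {(\<tau>\<^sub>1 ` K\<^sub>1, \<tau>\<^sub>2 ` K\<^sub>2) | K\<^sub>1 K\<^sub>2.
            K\<^sub>1 \<in> bedges M \<and> K\<^sub>2 \<in> bedges M \<and> K\<^sub>2 \<subseteq> L \<and> X \<subseteq> K\<^sub>1 \<inter> K\<^sub>2}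
       \<union> {(\<tau>\<^sub>2 ` K\<^sub>2, \<tau>\<^sub>1 ` K\<^sub>1) | K\<^sub>1 K\<^sub>2.
            K\<^sub>1 \<in> bedges M \<and> K\<^sub>2 \<in> bedges M \<and> K\<^sub>2 \<subseteq> L \<and> X \<subseteq> K\<^sub>1 \<inter> K\<^sub>2}\<rparr>"

text \<open>\<open>r\<^bsub>L,X\<^esub>(M)\<close> is determined only up to the names of the vertices of the glued union, so the
  operation is a relation: \<open>M'\<close> may be any such copy with vertices in \<open>'b\<close>.\<close>

definition is_reflection ::
    "'a b_hypergraph \<Rightarrow> 'a set \<Rightarrow> 'a set \<Rightarrow> 'b b_hypergraph \<Rightarrow> bool" where
  "is_reflection M L X M' \<longleftrightarrow> L \<in> bedges M \<and> X \<subseteq> L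
     \<and> (\<exists>\<tau>\<^sub>1 \<tau>\<^sub>2. gluing_maps (bverts M) L X \<tau>\<^sub>1 \<tau>\<^sub>2 \<and> M' = reflection \<tau>\<^sub>1 \<tau>\<^sub>2 M L X)"

inductive_set reflection_complexes :: "nat \<Rightarrow> nat b_hypergraph set" for k :: nat where
  trivial: "trivial_complex k \<in> reflection_complexes k"
| reflect: "\<lbrakk>M \<in> reflection_complexes k; is_reflection M L X M'\<rbrakk>
    \<Longrightarrow> M' \<in> reflection_complexes k"

definition frame :: "nat \<Rightarrow> 'a b_hypergraph \<Rightarrow> 'a hypergraph" where
  "frame k M = \<lparr>hverts = bverts M, hedges = {e \<in> bedges M. card e = k}\<rparr>"

definition spanned :: "'a hypergraph \<Rightarrow> 'a set \<Rightarrow> 'a hypergraph" where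
  "spanned H X = \<lparr>hverts = X, hedges = {e \<in> hedges H. e \<subseteq> X}\<rparr>"

definition Z_hypergraphs :: "nat \<Rightarrow> 'a hypergraph set" where
  "Z_hypergraphs k = {H. k_uniform k H \<and> pairwise disjnt (hedges H)}"

inductive_set C_complexes :: "nat \<Rightarrow> nat b_hypergraph set" for k :: nat where
  trivial: "trivial_complex k \<in> C_complexes k"
| reflect: "\<lbrakk>M \<in> C_complexes k; is_reflection M L X M'; spanned (frame k M) X \<in> Z_hypergraphs k\<rbrakk>
    \<Longrightarrow> M' \<in> C_complexes k"

definition R_hypergraphs :: "nat \<Rightarrow> nat hypergraph set" where
  "R_hypergraphs k = frame k ` C_complexes k"

lemma is_b_hypergraph_reflection_complex:
  assumes "M \<in> reflection_complexes k"
  shows "is_b_hypergraph M"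
  using assms
proof induction
  case trivial
  show ?case by (simp add: is_b_hypergraph_def trivial_complex_def sym_def)
next
  case (reflect M L X M')
  then obtain \<tau>\<^sub>1 \<tau>\<^sub>2 where L: "L \<in> bedges M" and M': "M' = reflection \<tau>\<^sub>1 \<tau>\<^sub>2 M L X"
    by (auto simp: is_reflection_def)
  have fin: "finite (bverts M)" and E: "bedges M \<subseteq> Pow (bverts M)"
    and B: "brel M \<subseteq> Pow (bverts M) \<times> Pow (bverts M)" and s: "sym (brel M)"
    using reflect.IH by (auto simp: is_b_hypergraph_def)
  have "L \<subseteq> bverts M" using L E by auto
  then have "finite (bverts M')"
    using fin by (auto simp: M' reflection_def intro: finite_subset)
  moreover have "bedges M' \<subseteq> Pow (bverts M')"
    using E by (fastforce simp: M' reflection_def)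
  moreover have "brel M' \<subseteq> Pow (bverts M') \<times> Pow (bverts M')"
    unfolding M' reflection_def using E B by (auto simp: subset_iff)
  moreover have "sym (brel M')"
  proof (rule symI)
    fix S T assume "(S, T) \<in> brel M'"
    then consider
        (1) A C where "S = \<tau>\<^sub>1 ` A" "T = \<tau>\<^sub>1 ` C" "(C, A) \<in> brel M"
      | (2) A C where "S = \<tau>\<^sub>2 ` A" "T = \<tau>\<^sub>2 ` C" "(C, A) \<in> brel M" "A \<subseteq> L" "C \<subseteq> L"
      | (3) K\<^sub>1 K\<^sub>2 where "S = \<tau>\<^sub>1 ` K\<^sub>1" "T = \<tau>\<^sub>2 ` K\<^sub>2"
          "K\<^sub>1 \<in> bedges M" "K\<^sub>2 \<in> bedges M" "K\<^sub>2 \<subseteq> L" "X \<subseteq> K\<^sub>1 \<inter> K\<^sub>2"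
      | (4) K\<^sub>1 K\<^sub>2 where "T = \<tau>\<^sub>1 ` K\<^sub>1" "S = \<tau>\<^sub>2 ` K\<^sub>2"
          "K\<^sub>1 \<in> bedges M" "K\<^sub>2 \<in> bedges M" "K\<^sub>2 \<subseteq> L" "X \<subseteq> K\<^sub>1 \<inter> K\<^sub>2"
      unfolding M' reflection_def by (auto dest: symD[OF s])
    then show "(T, S) \<in> brel M'"
    proof cases
      case 1 then show ?thesis unfolding M' reflection_def by auto
    next
      case 2 then show ?thesis unfolding M' reflection_def by auto
    next
      case 3 then show ?thesis unfolding M' reflection_def by auto
    next
      case 4 then show ?thesis unfolding M' reflection_def by auto
    qed
  qed
  ultimately show ?case by (simp add: is_b_hypergraph_def)
qed


subsection \<open>Weak thickness\<close>

instantiation "fun" :: (type, real_vector) real_vector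
begin

definition "scaleR_fun c f = (\<lambda>x. c *\<^sub>R f x)"

instance
  by standard (auto simp: scaleR_fun_def fun_eq_iff scaleR_add_right scaleR_add_left)

end

text \<open>The space of real functions on the power set of \<open>V\<close> is represented by the functions
  on \<^typ>\<open>'a set\<close> that vanish outside \<^term>\<open>Pow V\<close>; all vectors below are of this form.\<close>

definition ind :: "'a set \<Rightarrow> 'a set \<Rightarrow> real" where
  "ind S = (\<lambda>T. if T = S then 1 else 0)"

definition tvec :: "'a set \<Rightarrow> 'a set \<Rightarrow> 'a set \<Rightarrow> real" where
  "tvec A C = ind (A \<union> C) - ind A - ind C + ind (A \<inter> C)"

definition W_space :: "('a set \<times> 'a set) set \<Rightarrow> ('a set \<Rightarrow> real) set" where
  "W_space B = span {tvec A C | A C. (A, C) \<in> B}"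

definition Q_cone :: "'a set \<Rightarrow> ('a set \<Rightarrow> real) set" where
  "Q_cone V = {c *\<^sub>R ind {} + q | c q. q \<in> convex_cone hull
     ({tvec A C | A C. A \<subseteq> V \<and> C \<subseteq> V} \<union> {ind A | A. A \<subseteq> V})}"

definition svec :: "'a hypergraph \<Rightarrow> 'a set \<Rightarrow> real" where
  "svec H = - ind (hverts H) + (\<Sum>e\<in>hedges H. ind e)"

definition weakly_thick_complex :: "nat \<Rightarrow> 'a b_hypergraph \<Rightarrow> bool" where
  "weakly_thick_complex k M \<longleftrightarrow>
     (\<exists>w\<in>W_space (brel M). \<exists>q\<in>Q_cone (bverts M). svec (frame k M) = w + q)"

definition weakly_thick :: "nat \<Rightarrow> nat hypergraph \<Rightarrow> bool" where
  "weakly_thick k H \<longleftrightarrow> (\<exists>M\<in>reflection_complexes k. frame k M = H \<and> weakly_thick_complex k M)"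

end

theory Submission
  imports Defs
begin

text \<open>Thickness: for every edge \<open>K\<close> of a complex in \<open>\<C>\<^sub>k\<close>, the vector
  \<open>-1\<^sub>K + \<Sum>\<^bsub>e \<subseteq> K\<^esub> 1\<^sub>e\<close> lies in \<open>W + Q\<^sub>K\<close>, where \<open>W\<close> is spanned by the relation restricted to \<open>K\<close>.
  For a cross edge \<open>K = \<tau>\<^sub>1 K\<^sub>1 \<union> \<tau>\<^sub>2 K\<^sub>2\<close> the vector is the sum of the images of the vectors of \<open>K\<^sub>1\<close> and
  \<open>K\<^sub>2\<close>, of \<open>-t\<close> for the new pair of the relation, and of the image of \<open>1\<^sub>X - \<Sum>\<^bsub>e \<subseteq> X\<^esub> 1\<^sub>e\<close>, which is in
  \<open>Q\<^sub>X\<close> because the edges inside \<open>X\<close> are disjoint.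

  Sidorenko: starting from a uniformly random edge of \<open>G\<close> and gluing conditionally independent
  copies along \<open>X\<close> at each reflection, one gets a random homomorphism from the frame to \<open>G\<close>
  whose edge marginals are uniform and for which the pairs of the relation are conditionally
  independent.  The relative entropy \<open>h(S)\<close> of its marginal on \<open>S\<close> with respect to the uniform
  distribution is nonnegative and supermodular, hence nonnegative on \<open>Q\<^sub>V\<close>, and it vanishes on \<open>W\<^sub>B\<close>.
  So weak thickness gives \<open>h(V) \<le> \<Sum>\<^sub>e h(e)\<close>, while \<open>h(V) \<ge> - ln t(H,G)\<close> and
  \<open>h(e) = - ln t(e\<^sub>k,G)\<close>.\<close>

subsection \<open>Edges of reflections\<close>

lemma C_complex_imp_reflection_complex:
  "M \<in> C_complexes k \<Longrightarrow> M \<in> reflection_complexes k"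
  by (induction rule: C_complexes.induct) (auto intro: reflection_complexes.intros)

lemma bedges_reflectionE:
  assumes "K \<in> bedges (reflection \<tau>\<^sub>1 \<tau>\<^sub>2 M L X)"
  obtains (left) K\<^sub>1 where "K\<^sub>1 \<in> bedges M" "K = \<tau>\<^sub>1 ` K\<^sub>1"
  | (right) K\<^sub>2 where "K\<^sub>2 \<in> bedges M" "K\<^sub>2 \<subseteq> L" "K = \<tau>\<^sub>2 ` K\<^sub>2"
  | (both) K\<^sub>1 K\<^sub>2 where "K\<^sub>1 \<in> bedges M" "K\<^sub>2 \<in> bedges M" "K\<^sub>2 \<subseteq> L" "X \<subseteq> K\<^sub>1" "X \<subseteq> K\<^sub>2"
      "K = \<tau>\<^sub>1 ` K\<^sub>1 \<union> \<tau>\<^sub>2 ` K\<^sub>2"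
  using assms by (auto simp: reflection_def)

lemma gluing_maps_inj:
  assumes "gluing_maps V L X \<tau>\<^sub>1 \<tau>\<^sub>2"
  shows "inj_on \<tau>\<^sub>1 V" "inj_on \<tau>\<^sub>2 L"
  using assms by (auto simp: gluing_maps_def)

lemma gluing_maps_eq_iff:
  assumes "gluing_maps V L X \<tau>\<^sub>1 \<tau>\<^sub>2" "v \<in> V" "l \<in> L"
  shows "\<tau>\<^sub>1 v = \<tau>\<^sub>2 l \<longleftrightarrow> v = l \<and> l \<in> X"
  using assms by (auto simp: gluing_maps_def)

lemma gluing_maps_image_eq:
  assumes g: "gluing_maps V L X \<tau>\<^sub>1 \<tau>\<^sub>2" and "L \<subseteq> V" "X \<subseteq> L" "S \<subseteq> X"
  shows "\<tau>\<^sub>2 ` S = \<tau>\<^sub>1 ` S"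
proof (rule image_cong[OF refl])
  fix x assume "x \<in> S"
  then show "\<tau>\<^sub>2 x = \<tau>\<^sub>1 x" using assms(2-4) gluing_maps_eq_iff[OF g, of x x] by force
qed

text \<open>A point reaches the cross set either from its own half or as an identified point of
  \<open>X\<close> lying in the other half. Taking one half empty covers the one-sided
  edges.\<close>

lemma gluing_maps_image_subset_iff:
  assumes g: "gluing_maps V L X \<tau>\<^sub>1 \<tau>\<^sub>2" and L: "L \<subseteq> V" and X: "X \<subseteq> L"
    and K: "K\<^sub>1 \<subseteq> V" "K\<^sub>2 \<subseteq> L"
  shows "A \<subseteq> V \<Longrightarrow> \<tau>\<^sub>1 ` A \<subseteq> \<tau>\<^sub>1 ` K\<^sub>1 \<union> \<tau>\<^sub>2 ` K\<^sub>2 \<longleftrightarrow> A \<subseteq> K\<^sub>1 \<union> X \<inter> K\<^sub>2"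
    and "C \<subseteq> L \<Longrightarrow> \<tau>\<^sub>2 ` C \<subseteq> \<tau>\<^sub>1 ` K\<^sub>1 \<union> \<tau>\<^sub>2 ` K\<^sub>2 \<longleftrightarrow> C \<subseteq> K\<^sub>2 \<union> X \<inter> K\<^sub>1"
proof -
  have 1: "\<tau>\<^sub>1 a \<in> \<tau>\<^sub>1 ` K\<^sub>1 \<union> \<tau>\<^sub>2 ` K\<^sub>2 \<longleftrightarrow> a \<in> K\<^sub>1 \<union> X \<inter> K\<^sub>2" if "a \<in> V" for a
  proof -
    have "\<tau>\<^sub>1 a \<in> \<tau>\<^sub>1 ` K\<^sub>1 \<longleftrightarrow> a \<in> K\<^sub>1"
      using inj_on_image_mem_iff[OF gluing_maps_inj(1)[OF g] that K(1)] .
    moreover have "\<tau>\<^sub>1 a \<in> \<tau>\<^sub>2 ` K\<^sub>2 \<longleftrightarrow> a \<in> X \<inter> K\<^sub>2"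
      unfolding image_iff using gluing_maps_eq_iff[OF g that subsetD[OF K(2)]] by auto
    ultimately show ?thesis by auto
  qed
  have 2: "\<tau>\<^sub>2 a \<in> \<tau>\<^sub>1 ` K\<^sub>1 \<union> \<tau>\<^sub>2 ` K\<^sub>2 \<longleftrightarrow> a \<in> K\<^sub>2 \<union> X \<inter> K\<^sub>1" if "a \<in> L" for a
  proof -
    have "\<tau>\<^sub>2 a \<in> \<tau>\<^sub>2 ` K\<^sub>2 \<longleftrightarrow> a \<in> K\<^sub>2"
      using inj_on_image_mem_iff[OF gluing_maps_inj(2)[OF g] that K(2)] .
    moreover have "\<tau>\<^sub>2 a \<in> \<tau>\<^sub>1 ` K\<^sub>1 \<longleftrightarrow> a \<in> X \<inter> K\<^sub>1"
      unfolding image_iff using gluing_maps_eq_iff[OF g subsetD[OF K(1)] that] by (metis Int_iff)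
    ultimately show ?thesis by auto
  qed
  show "A \<subseteq> V \<Longrightarrow> \<tau>\<^sub>1 ` A \<subseteq> \<tau>\<^sub>1 ` K\<^sub>1 \<union> \<tau>\<^sub>2 ` K\<^sub>2 \<longleftrightarrow> A \<subseteq> K\<^sub>1 \<union> X \<inter> K\<^sub>2"
    unfolding image_subset_iff subset_eq[of A] using 1 by (intro ball_cong) auto
  show "C \<subseteq> L \<Longrightarrow> \<tau>\<^sub>2 ` C \<subseteq> \<tau>\<^sub>1 ` K\<^sub>1 \<union> \<tau>\<^sub>2 ` K\<^sub>2 \<longleftrightarrow> C \<subseteq> K\<^sub>2 \<union> X \<inter> K\<^sub>1"
    unfolding image_subset_iff subset_eq[of C] using 2 by (intro ball_cong) auto
qed

text \<open>Only points of \<open>X\<close> are identified, and \<open>X\<close> lies in both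
  halves. This computes the intersection term of \<open>tvec\<close> for the new pairs of the
  relation.\<close>

lemma gluing_maps_image_Int:
  assumes g: "gluing_maps V L X \<tau>\<^sub>1 \<tau>\<^sub>2" and "L \<subseteq> V" "K\<^sub>1 \<subseteq> V" "K\<^sub>2 \<subseteq> L" "X \<subseteq> K\<^sub>1" "X \<subseteq> K\<^sub>2"
  shows "\<tau>\<^sub>1 ` K\<^sub>1 \<inter> \<tau>\<^sub>2 ` K\<^sub>2 = \<tau>\<^sub>1 ` X"
proof -
  have "\<tau>\<^sub>1 a = \<tau>\<^sub>2 c \<longleftrightarrow> a = c \<and> c \<in> X" if "a \<in> K\<^sub>1" "c \<in> K\<^sub>2" for a c
    using gluing_maps_eq_iff[OF g] that assms(3,4) by auto
  then have "\<tau>\<^sub>1 ` K\<^sub>1 \<inter> \<tau>\<^sub>2 ` K\<^sub>2 \<subseteq> \<tau>\<^sub>1 ` X" by (auto simp: image_iff)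
  moreover have "\<tau>\<^sub>1 ` X \<subseteq> \<tau>\<^sub>2 ` K\<^sub>2"
    using gluing_maps_image_eq[OF g assms(2), of X] assms by blast
  ultimately show ?thesis using assms(5) by blast
qed

text \<open>The first claim lets statements about all edges be applied to the whole vertex set; the
  second controls which cross edges can have \<open>k\<close> elements.\<close>

lemma reflection_complex_edges:
  assumes "M \<in> reflection_complexes k"
  shows "bverts M \<in> bedges M" "K \<in> bedges M \<Longrightarrow> k \<le> card K"
proof -
  have "bverts M \<in> bedges M \<and> (\<forall>K\<in>bedges M. k \<le> card K)"
    using assms
  proof induction
    case trivial
    show ?case by (simp add: trivial_complex_def)
  next
    case (reflect M L X M')
    then obtain \<tau>\<^sub>1 \<tau>\<^sub>2 where L: "L \<in> bedges M" and X: "X \<subseteq> L"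
      and g: "gluing_maps (bverts M) L X \<tau>\<^sub>1 \<tau>\<^sub>2" and M': "M' = reflection \<tau>\<^sub>1 \<tau>\<^sub>2 M L X"
      by (auto simp: is_reflection_def)
    have b: "finite (bverts M)" "bedges M \<subseteq> Pow (bverts M)"
      using is_b_hypergraph_reflection_complex[OF reflect.hyps(1)] by (auto simp: is_b_hypergraph_def)
    have sub: "K \<subseteq> bverts M" if "K \<in> bedges M" for K using b(2) that by auto
    have c1: "k \<le> card (\<tau>\<^sub>1 ` K)" if "K \<in> bedges M" for K
      using card_image[OF inj_on_subset[OF gluing_maps_inj(1)[OF g] sub[OF that]]] reflect.IH that
      by simp
    have c2: "k \<le> card (\<tau>\<^sub>2 ` K)" if "K \<in> bedges M" "K \<subseteq> L" for K
      using card_image[OF inj_on_subset[OF gluing_maps_inj(2)[OF g] that(2)]] reflect.IH that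
      by simp
    have "k \<le> card K" if "K \<in> bedges M'" for K
      using that unfolding M'
    proof (cases rule: bedges_reflectionE)
      case (both K\<^sub>1 K\<^sub>2)
      have "finite K"
        using both b(1) sub by (metis finite_UnI finite_imageI finite_subset)
      then have "card (\<tau>\<^sub>1 ` K\<^sub>1) \<le> card K" using both by (auto intro: card_mono)
      then show ?thesis using c1[of K\<^sub>1] both by simp
    qed (use c1 c2 in auto)
    moreover have "bverts M' \<in> bedges M'"
    proof -
      \<comment> \<open>The whole glued vertex set is the cross edge with
        \<open>K\<^sub>1 = bverts M\<close> and \<open>K\<^sub>2 = L\<close>.\<close>
      have "X \<subseteq> bverts M \<inter> L" using X sub[OF L] by auto
      then show ?thesis using reflect.IH L unfolding M' reflection_def by (simp, blast)
    qed
    ultimately show ?case by blast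
  qed
  then show "bverts M \<in> bedges M" "K \<in> bedges M \<Longrightarrow> k \<le> card K" by auto
qed

text \<open>A cross edge \<open>\<tau>\<^sub>1 K\<^sub>1 \<union> \<tau>\<^sub>2 K\<^sub>2\<close> can only have \<open>k\<close> elements if it equals \<open>\<tau>\<^sub>1 K\<^sub>1\<close>, since
  no edge of a reflection complex has fewer than \<open>k\<close> elements.\<close>

lemma hedges_frame_reflection:
  assumes M: "M \<in> reflection_complexes k" and L: "L \<in> bedges M"
    and g: "gluing_maps (bverts M) L X \<tau>\<^sub>1 \<tau>\<^sub>2"
  shows "hedges (frame k (reflection \<tau>\<^sub>1 \<tau>\<^sub>2 M L X)) =
    (`) \<tau>\<^sub>1 ` hedges (frame k M) \<union> (`) \<tau>\<^sub>2 ` {e \<in> hedges (frame k M). e \<subseteq> L}" (is "?l = ?r")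
proof -
  have b: "finite (bverts M)" "bedges M \<subseteq> Pow (bverts M)"
    using is_b_hypergraph_reflection_complex[OF M] by (auto simp: is_b_hypergraph_def)
  have c1: "card (\<tau>\<^sub>1 ` K) = card K" if "K \<in> bedges M" for K
    using card_image[OF inj_on_subset[OF gluing_maps_inj(1)[OF g]]] that b by auto
  have c2: "card (\<tau>\<^sub>2 ` K) = card K" if "K \<subseteq> L" for K
    using card_image[OF inj_on_subset[OF gluing_maps_inj(2)[OF g]]] that by auto
  have "e \<in> ?r" if "e \<in> ?l" for e
  proof -
    have e: "e \<in> bedges (reflection \<tau>\<^sub>1 \<tau>\<^sub>2 M L X)" "card e = k" using that by (auto simp: frame_def)
    from e(1) show ?thesis
    proof (cases rule: bedges_reflectionE)
      case (both K\<^sub>1 K\<^sub>2)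
      have "finite e"
        using both b by (metis PowD finite_UnI finite_imageI finite_subset subsetD)
      moreover have "card e \<le> card (\<tau>\<^sub>1 ` K\<^sub>1)"
        using reflection_complex_edges(2)[OF M both(1)] c1[OF both(1)] e(2) by simp
      moreover have "\<tau>\<^sub>1 ` K\<^sub>1 \<subseteq> e" using both(6) by simp
      ultimately have "\<tau>\<^sub>1 ` K\<^sub>1 = e"
        by (intro card_seteq)
      then have "e \<in> (`) \<tau>\<^sub>1 ` hedges (frame k M)"
        using both(1) e(2) c1[OF both(1)]
        by (intro image_eqI[of _ _ K\<^sub>1]) (simp_all add: frame_def)
      then show ?thesis ..
    qed (use e(2) c1 c2 in \<open>auto simp: frame_def\<close>)
  qed
  moreover have "?r \<subseteq> ?l"
    using c1 c2 by (auto simp: frame_def reflection_def)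
  ultimately show ?thesis by (intro subset_antisym subsetI) auto
qed

subsection \<open>Weak thickness of the complexes in \<open>\<C>\<^sub>k\<close>\<close>

text \<open>Linear push-forward of set functions. Written with preimages it is visibly linear; when
  \<open>\<tau>\<close> is injective on \<open>V\<close> it sends the indicator of a subset to the
  indicator of its image.\<close>

definition push :: "('a \<Rightarrow> 'b) \<Rightarrow> 'a set \<Rightarrow> ('a set \<Rightarrow> real) \<Rightarrow> 'b set \<Rightarrow> real" where
  "push \<tau> V x = (\<lambda>T. if T \<subseteq> \<tau> ` V then x (\<tau> -` T \<inter> V) else 0)"

lemma linear_push: "linear (push \<tau> V)"
  by (rule linearI) (auto simp: push_def fun_eq_iff scaleR_fun_def)

lemma push_ind:
  assumes "inj_on \<tau> V" "S \<subseteq> V"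
  shows "push \<tau> V (ind S) = ind (\<tau> ` S)"
proof
  fix T
  have "\<tau> ` (\<tau> -` T \<inter> V) = T" if "T \<subseteq> \<tau> ` V"
    using that by auto
  moreover have "\<tau> -` (\<tau> ` S) \<inter> V = S"
    using assms by (auto simp: inj_on_def)
  ultimately have "T \<subseteq> \<tau> ` V \<Longrightarrow> \<tau> -` T \<inter> V = S \<longleftrightarrow> T = \<tau> ` S"
    by metis
  moreover have "T = \<tau> ` S \<Longrightarrow> T \<subseteq> \<tau> ` V" using assms by auto
  ultimately show "push \<tau> V (ind S) T = ind (\<tau> ` S) T"
    by (auto simp: push_def ind_def)
qed

text \<open>Injectivity makes images commute with intersections, as the last term of
  \<open>tvec\<close> requires.\<close>

lemma push_tvec:
  assumes "inj_on \<tau> V" "A \<subseteq> V" "C \<subseteq> V"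
  shows "push \<tau> V (tvec A C) = tvec (\<tau> ` A) (\<tau> ` C)"
proof -
  have *: "A \<inter> C \<subseteq> V" "A \<union> C \<subseteq> V" using assms by auto
  show ?thesis
    using assms * by (simp add: tvec_def linear_add[OF linear_push] linear_diff[OF linear_push]
        push_ind image_Un inj_on_image_Int)
qed

text \<open>Only pairs inside \<open>K\<close> may be used: \<open>\<tau>\<^sub>2\<close> carries
  over just the pairs of the relation inside \<open>L\<close>, so this restriction makes membership
  transferable along both gluing maps.\<close>

definition thick_cone :: "('a set \<times> 'a set) set \<Rightarrow> 'a set \<Rightarrow> ('a set \<Rightarrow> real) set" where
  "thick_cone B K = {w + q | w q. w \<in> W_space (B \<inter> Pow K \<times> Pow K) \<and> q \<in> Q_cone K}"

section \<open>Closure properties of the cones\<close>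

abbreviation Q_generators :: "'a set \<Rightarrow> ('a set \<Rightarrow> real) set" where
  "Q_generators V \<equiv> {tvec A C | A C. A \<subseteq> V \<and> C \<subseteq> V} \<union> {ind A | A. A \<subseteq> V}"

lemma Q_cone_add:
  assumes "x \<in> Q_cone V" "y \<in> Q_cone V"
  shows "x + y \<in> Q_cone V"
proof -
  obtain c q d r where *: "x = c *\<^sub>R ind {} + q" "y = d *\<^sub>R ind {} + r"
    and "q \<in> convex_cone hull Q_generators V" "r \<in> convex_cone hull Q_generators V"
    using assms by (auto simp: Q_cone_def)
  then have "q + r \<in> convex_cone hull Q_generators V"
    by (intro convex_cone_add[OF convex_cone_convex_cone_hull])
  moreover have "x + y = (c + d) *\<^sub>R ind {} + (q + r)"
    by (simp add: * scaleR_add_left)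
  ultimately show ?thesis unfolding Q_cone_def by blast
qed

lemma scaleR_ind_empty_in_Q_cone: "c *\<^sub>R ind {} \<in> Q_cone V"
  unfolding Q_cone_def using convex_cone_hull_contains_0
  by (fastforce intro: exI[of _ c] exI[of _ 0])

lemma hull_subset_Q_cone: "convex_cone hull Q_generators V \<subseteq> Q_cone V"
  unfolding Q_cone_def by (force intro: exI[of _ 0])

lemma tvec_in_Q_cone: "A \<subseteq> V \<Longrightarrow> C \<subseteq> V \<Longrightarrow> tvec A C \<in> Q_cone V"
  by (rule subsetD[OF hull_subset_Q_cone]) (auto intro: hull_inc)

lemma ind_in_Q_cone: "A \<subseteq> V \<Longrightarrow> ind A \<in> Q_cone V"
  by (rule subsetD[OF hull_subset_Q_cone]) (auto intro: hull_inc)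

text \<open>Generators go to generators, so the hull goes into the hull, and \<open>ind {}\<close>
  is fixed. The target \<open>K'\<close> may exceed the image, so that a half can be placed inside a
  cross edge.\<close>

lemma push_in_Q_cone:
  assumes i: "inj_on \<tau> V" and "K \<subseteq> V" and x: "x \<in> Q_cone K" and K': "\<tau> ` K \<subseteq> K'"
  shows "push \<tau> V x \<in> Q_cone K'"
proof -
  obtain c q where x: "x = c *\<^sub>R ind {} + q" and q: "q \<in> convex_cone hull Q_generators K"
    using x by (auto simp: Q_cone_def)
  have "push \<tau> V ` Q_generators K \<subseteq> Q_generators K'"
  proof safe
    fix A C assume *: "A \<subseteq> K" "C \<subseteq> K"
    have "push \<tau> V (tvec A C) = tvec (\<tau> ` A) (\<tau> ` C)"
      using * assms(2) by (intro push_tvec[OF i]) auto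
    moreover have "\<tau> ` A \<subseteq> K'" "\<tau> ` C \<subseteq> K'" using * K' by auto
    ultimately show "\<exists>A' C'. push \<tau> V (tvec A C) = tvec A' C' \<and> A' \<subseteq> K' \<and> C' \<subseteq> K'"
      by (intro exI[of _ "\<tau> ` A"] exI[of _ "\<tau> ` C"]) simp
  next
    \<comment> \<open>Membership in the union of the two generator families has become an
      implication whose premise denies that the image is an indicator; it is one, so the premise is
      contradictory.\<close>
    fix A assume "A \<subseteq> K" "\<nexists>A'. push \<tau> V (ind A) = ind A' \<and> A' \<subseteq> K'"
    moreover have "push \<tau> V (ind A) = ind (\<tau> ` A)"
      using \<open>A \<subseteq> K\<close> assms by (intro push_ind) auto
    ultimately show "\<exists>A' C'. push \<tau> V (ind A) = tvec A' C' \<and> A' \<subseteq> K' \<and> C' \<subseteq> K'"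
      using K' by blast
  qed
  then have "push \<tau> V ` (convex_cone hull Q_generators K) \<subseteq> convex_cone hull Q_generators K'"
    unfolding convex_cone_hull_linear_image[OF linear_push, symmetric] by (rule hull_mono)
  moreover have "push \<tau> V x = c *\<^sub>R ind {} + push \<tau> V q"
    using i by (simp add: x linear_add[OF linear_push] linear_scale[OF linear_push] push_ind)
  ultimately show ?thesis using q unfolding Q_cone_def by blast
qed

lemma Q_cone_subset_thick_cone: "Q_cone K \<subseteq> thick_cone B K"
  unfolding thick_cone_def W_space_def using span_zero by force

lemma thick_cone_add:
  assumes "x \<in> thick_cone B K" "y \<in> thick_cone B K"
  shows "x + y \<in> thick_cone B K"
proof -
  obtain w q v r where "x = w + q" "y = v + r" "q \<in> Q_cone K" "r \<in> Q_cone K"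
    "w \<in> W_space (B \<inter> Pow K \<times> Pow K)" "v \<in> W_space (B \<inter> Pow K \<times> Pow K)"
    using assms by (auto simp: thick_cone_def)
  moreover have "x + y = (w + v) + (q + r)" using calculation by simp
  ultimately show ?thesis
    unfolding thick_cone_def W_space_def using Q_cone_add span_add by blast
qed

text \<open>\<open>W_space\<close> is a linear space, so the sign is free for pairs of the relation,
  whereas \<open>Q_cone\<close> offers the vectors \<open>tvec A C\<close> with positive sign
  only.\<close>

lemma uminus_tvec_in_thick_cone:
  assumes "(A, C) \<in> B" "A \<subseteq> K" "C \<subseteq> K"
  shows "- tvec A C \<in> thick_cone B K"
proof -
  have "- tvec A C \<in> W_space (B \<inter> Pow K \<times> Pow K)"
    unfolding W_space_def using assms by (intro span_neg span_base) blast
  moreover have "0 \<in> Q_cone K" using scaleR_ind_empty_in_Q_cone[of 0] by simp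
  ultimately show ?thesis
    unfolding thick_cone_def by (intro CollectI exI[of _ "- tvec A C"] exI[of _ 0]) simp
qed

lemma push_in_thick_cone:
  assumes i: "inj_on \<tau> V" and K: "K \<subseteq> V" and x: "x \<in> thick_cone B K" and K': "\<tau> ` K \<subseteq> K'"
    and B': "\<And>A C. (A, C) \<in> B \<Longrightarrow> A \<subseteq> K \<Longrightarrow> C \<subseteq> K \<Longrightarrow> (\<tau> ` A, \<tau> ` C) \<in> B'"
  shows "push \<tau> V x \<in> thick_cone B' K'"
proof -
  obtain w q where x: "x = w + q" and w: "w \<in> W_space (B \<inter> Pow K \<times> Pow K)" and q: "q \<in> Q_cone K"
    using x by (auto simp: thick_cone_def)
  have "push \<tau> V ` {tvec A C | A C. (A, C) \<in> B \<inter> Pow K \<times> Pow K}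
      \<subseteq> {tvec A C | A C. (A, C) \<in> B' \<inter> Pow K' \<times> Pow K'}"
  proof safe
    fix A C assume *: "(A, C) \<in> B" "A \<subseteq> K" "C \<subseteq> K"
    have "push \<tau> V (tvec A C) = tvec (\<tau> ` A) (\<tau> ` C)"
      using * K by (intro push_tvec[OF i]) auto
    moreover have "\<tau> ` A \<subseteq> K'" "\<tau> ` C \<subseteq> K'" using * K' by auto
    ultimately show "\<exists>A' C'. push \<tau> V (tvec A C) = tvec A' C' \<and> (A', C') \<in> B' \<inter> Pow K' \<times> Pow K'"
      using B'[OF *] by (intro exI[of _ "\<tau> ` A"] exI[of _ "\<tau> ` C"]) simp
  qed
  then have "push \<tau> V ` W_space (B \<inter> Pow K \<times> Pow K) \<subseteq> W_space (B' \<inter> Pow K' \<times> Pow K')"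
    unfolding W_space_def linear_span_image[OF linear_push, symmetric] by (rule span_mono)
  then show ?thesis
    using w push_in_Q_cone[OF i K q K'] unfolding x thick_cone_def linear_add[OF linear_push] by blast
qed

text \<open>Peel the disjoint edges off \<open>X\<close> one at a time; each removal costs a
  \<open>tvec\<close> and a multiple of \<open>ind {}\<close>, and what remains at the end is the
  indicator of the uncovered vertices.\<close>

lemma Z_hypergraph_in_Q_cone:
  assumes "spanned H X \<in> Z_hypergraphs k" "X \<subseteq> K"
  shows "ind X - (\<Sum>e | e \<in> hedges H \<and> e \<subseteq> X. ind e) \<in> Q_cone K"
proof -
  \<comment> \<open>The ground set \<open>Y\<close> must vary, because removing an edge
    \<open>e\<close> leaves the smaller set \<open>Y - e\<close>.\<close>
  have gen: "ind Y - (\<Sum>e\<in>D. ind e) \<in> Q_cone K"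
    if "finite D" "pairwise disjnt D" "\<Union>D \<subseteq> Y" "Y \<subseteq> K" for D Y
    using that
  proof (induction D arbitrary: Y rule: finite_induct)
    case empty
    then show ?case by (simp add: ind_in_Q_cone)
  next
    case (insert e D)
    have "\<Union>D \<subseteq> Y - e"
    proof -
      have "d \<inter> e = {}" if "d \<in> D" for d
        using insert.prems(1) insert.hyps(2) that by (auto simp: pairwise_insert disjnt_def)
      then show ?thesis using insert.prems(2) by blast
    qed
    then have "ind (Y - e) - (\<Sum>e\<in>D. ind e) \<in> Q_cone K"
      using insert.prems by (intro insert.IH) (auto simp: pairwise_insert)
    moreover have "tvec (Y - e) e \<in> Q_cone K"
      using insert.prems by (intro tvec_in_Q_cone) auto
    \<comment> \<open>The parts \<open>Y - e\<close> and \<open>e\<close> are disjoint, so the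
      intersection term of \<open>tvec\<close> is \<open>ind {}\<close>; it is cancelled by a
      negative multiple, which \<open>Q_cone\<close> allows for \<open>ind {}\<close>.\<close>
    moreover have "ind Y - (\<Sum>e\<in>insert e D. ind e)
        = (ind (Y - e) - (\<Sum>e\<in>D. ind e)) + (tvec (Y - e) e + (- 1) *\<^sub>R ind {})"
    proof -
      have "Y - e \<union> e = Y" "(Y - e) \<inter> e = {}" using insert.prems by auto
      then show ?thesis using insert.hyps by (simp add: tvec_def)
    qed
    ultimately show ?case using Q_cone_add scaleR_ind_empty_in_Q_cone by metis
  qed
  have "finite X" "pairwise disjnt {e. e \<in> hedges H \<and> e \<subseteq> X}"
    using assms(1) by (auto simp: Z_hypergraphs_def spanned_def k_uniform_def)
  moreover have "{e. e \<in> hedges H \<and> e \<subseteq> X} \<subseteq> Pow X" by auto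
  ultimately show ?thesis using assms(2) by (intro gen) (auto intro: finite_subset)
qed

section \<open>Thickness of every edge, by induction on the reflections\<close>

lemma svec_spanned: "svec (spanned H K) = - ind K + (\<Sum>e | e \<in> hedges H \<and> e \<subseteq> K. ind e)"
  by (simp add: svec_def spanned_def)

lemma push_sum_ind:
  assumes "inj_on \<tau> V" "\<Union>D \<subseteq> V"
  shows "push \<tau> V (\<Sum>e\<in>D. ind e) = (\<Sum>e\<in>(`) \<tau> ` D. ind e)"
proof -
  have "inj_on ((`) \<tau>) D"
    using assms by (intro inj_onI) (metis inj_on_image_eq_iff Sup_le_iff)
  then have "(\<Sum>e\<in>(`) \<tau> ` D. ind e) = (\<Sum>e\<in>D. ind (\<tau> ` e))"
    by (simp add: sum.reindex)
  also have "\<dots> = (\<Sum>e\<in>D. push \<tau> V (ind e))"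
    using assms by (intro sum.cong) (auto simp: push_ind Sup_le_iff)
  finally show ?thesis by (simp add: linear_sum[OF linear_push])
qed

text \<open>The induction must treat all edges \<open>K\<close>, not only the whole vertex set,
  since a cross edge needs the claim for both of its halves.\<close>

lemma svec_spanned_in_thick_cone:
  assumes "M \<in> C_complexes k" "K \<in> bedges M"
  shows "svec (spanned (frame k M) K) \<in> thick_cone (brel M) K"
  using assms
proof (induction arbitrary: K)
  case trivial
  \<comment> \<open>The sole edge \<open>K\<close> spans only itself, so the vector is zero.\<close>
  have "{e. e \<in> hedges (frame k (trivial_complex k)) \<and> e \<subseteq> K} = {K}"
    using trivial by (auto simp: trivial_complex_def frame_def)
  then have "svec (spanned (frame k (trivial_complex k)) K) = 0 *\<^sub>R ind {}"
    by (simp add: svec_spanned del: zero_fun_apply)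
  then show ?case
    using scaleR_ind_empty_in_Q_cone Q_cone_subset_thick_cone by (metis subsetD)
next
  case (reflect M L X M')
  define V where "V = bverts M"
  define E where "E = hedges (frame k M)"
  from reflect obtain \<tau>\<^sub>1 \<tau>\<^sub>2 where L: "L \<in> bedges M" and X: "X \<subseteq> L"
    and g: "gluing_maps V L X \<tau>\<^sub>1 \<tau>\<^sub>2" and M': "M' = reflection \<tau>\<^sub>1 \<tau>\<^sub>2 M L X"
    by (auto simp: is_reflection_def V_def)
  have M: "M \<in> reflection_complexes k"
    using reflect.hyps(1) by (rule C_complex_imp_reflection_complex)
  have b: "finite V" "bedges M \<subseteq> Pow V"
    using is_b_hypergraph_reflection_complex[OF M] by (auto simp: is_b_hypergraph_def V_def)
  have sub: "S \<subseteq> V" if "S \<in> bedges M" for S using b(2) that by auto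
  note LV = sub[OF L]
  have E: "E \<subseteq> Pow V" "finite E"
    using b finite_subset[of E "Pow V"] by (auto simp: E_def frame_def)
  have E': "hedges (frame k M') = (`) \<tau>\<^sub>1 ` E \<union> (`) \<tau>\<^sub>2 ` {e \<in> E. e \<subseteq> L}"
    unfolding M' E_def using hedges_frame_reflection[OF M L] g by (simp add: V_def)
  have B1: "(\<tau>\<^sub>1 ` A, \<tau>\<^sub>1 ` C) \<in> brel M'" if "(A, C) \<in> brel M" for A C
    using that by (auto simp: M' reflection_def)
  have B2: "(\<tau>\<^sub>2 ` A, \<tau>\<^sub>2 ` C) \<in> brel M'" if "(A, C) \<in> brel M" "A \<subseteq> L" "C \<subseteq> L" for A C
    using that by (auto simp: M' reflection_def)
  note inj = gluing_maps_inj[OF g]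
  define S where "S K = {e. e \<in> E \<and> e \<subseteq> K}" for K
  have sv: "svec (spanned (frame k M) K) = - ind K + (\<Sum>e\<in>S K. ind e)" for K
    by (simp add: svec_spanned S_def E_def)
  have push1: "push \<tau>\<^sub>1 V (- ind K + (\<Sum>e\<in>S K. ind e)) = - ind (\<tau>\<^sub>1 ` K) + (\<Sum>e\<in>(`) \<tau>\<^sub>1 ` S K. ind e)"
    if "K \<subseteq> V" for K
  proof -
    have "\<Union>(S K) \<subseteq> V" using that by (auto simp: S_def)
    then show ?thesis
      using that inj by (simp add: linear_diff[OF linear_push] push_ind push_sum_ind)
  qed
  have push2: "push \<tau>\<^sub>2 L (- ind K + (\<Sum>e\<in>S K. ind e)) = - ind (\<tau>\<^sub>2 ` K) + (\<Sum>e\<in>(`) \<tau>\<^sub>2 ` S K. ind e)"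
    if "K \<subseteq> L" for K
  proof -
    have "\<Union>(S K) \<subseteq> L" using that by (auto simp: S_def)
    then show ?thesis
      using that inj by (simp add: linear_diff[OF linear_push] push_ind push_sum_ind)
  qed
  have thick1: "- ind (\<tau>\<^sub>1 ` K) + (\<Sum>e\<in>(`) \<tau>\<^sub>1 ` S K. ind e) \<in> thick_cone (brel M') K'"
    if "K \<in> bedges M" "\<tau>\<^sub>1 ` K \<subseteq> K'" for K K'
    unfolding push1[OF sub[OF that(1)], symmetric] sv[symmetric]
    by (intro push_in_thick_cone[OF inj(1) sub[OF that(1)] reflect.IH[OF that(1)] that(2)] B1)
  have thick2: "- ind (\<tau>\<^sub>2 ` K) + (\<Sum>e\<in>(`) \<tau>\<^sub>2 ` S K. ind e) \<in> thick_cone (brel M') K'"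
    if "K \<in> bedges M" "K \<subseteq> L" "\<tau>\<^sub>2 ` K \<subseteq> K'" for K K'
    unfolding push2[OF that(2), symmetric] sv[symmetric]
    using that(2)
    by (intro push_in_thick_cone[OF inj(2) that(2) reflect.IH[OF that(1)] that(3)] B2) auto
  \<comment> \<open>Stated for arbitrary, possibly empty halves, so that all three kinds of edges of
    the reflection are covered.\<close>
  have edges: "{e \<in> hedges (frame k M'). e \<subseteq> \<tau>\<^sub>1 ` K\<^sub>1 \<union> \<tau>\<^sub>2 ` K\<^sub>2}
      = (`) \<tau>\<^sub>1 ` S (K\<^sub>1 \<union> X \<inter> K\<^sub>2) \<union> (`) \<tau>\<^sub>2 ` {e \<in> S (K\<^sub>2 \<union> X \<inter> K\<^sub>1). e \<subseteq> L}"
    if "K\<^sub>1 \<subseteq> V" "K\<^sub>2 \<subseteq> L" for K\<^sub>1 K\<^sub>2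
  proof -
    note iff = gluing_maps_image_subset_iff[OF g LV X that]
    have "{e \<in> E. \<tau>\<^sub>1 ` e \<subseteq> \<tau>\<^sub>1 ` K\<^sub>1 \<union> \<tau>\<^sub>2 ` K\<^sub>2} = S (K\<^sub>1 \<union> X \<inter> K\<^sub>2)"
      unfolding S_def by (intro Collect_cong conj_cong refl iff(1)) (use E(1) in auto)
    moreover have "{e \<in> E. e \<subseteq> L \<and> \<tau>\<^sub>2 ` e \<subseteq> \<tau>\<^sub>1 ` K\<^sub>1 \<union> \<tau>\<^sub>2 ` K\<^sub>2} = {e \<in> S (K\<^sub>2 \<union> X \<inter> K\<^sub>1). e \<subseteq> L}"
      unfolding S_def using iff(2) by auto
    moreover have "{e \<in> (`) \<tau>\<^sub>1 ` E \<union> (`) \<tau>\<^sub>2 ` {e \<in> E. e \<subseteq> L}. e \<subseteq> U}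
        = (`) \<tau>\<^sub>1 ` {e \<in> E. \<tau>\<^sub>1 ` e \<subseteq> U} \<union> (`) \<tau>\<^sub>2 ` {e \<in> E. e \<subseteq> L \<and> \<tau>\<^sub>2 ` e \<subseteq> U}" for U
      by auto
    ultimately show ?thesis unfolding E' by simp
  qed
  from reflect.prems[unfolded M'] show ?case
  proof (cases rule: bedges_reflectionE)
    case (left K\<^sub>1)
    \<comment> \<open>A frame edge of the second copy inside the first half lies in
      \<open>X\<close>, where the two copies coincide, so it has already been counted.\<close>
    have "(`) \<tau>\<^sub>2 ` {e \<in> S (X \<inter> K\<^sub>1). e \<subseteq> L} \<subseteq> (`) \<tau>\<^sub>1 ` S K\<^sub>1"
      using gluing_maps_image_eq[OF g LV X] by (fastforce simp: S_def)
    then have K: "{e \<in> hedges (frame k M'). e \<subseteq> K} = (`) \<tau>\<^sub>1 ` S K\<^sub>1"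
      using edges[of K\<^sub>1 "{}"] sub[OF left(1)] left(2) by auto
    show ?thesis
      unfolding svec_spanned K unfolding left(2) by (rule thick1[OF left(1) order_refl])
  next
    case (right K\<^sub>2)
    have "(`) \<tau>\<^sub>1 ` S (X \<inter> K\<^sub>2) \<subseteq> (`) \<tau>\<^sub>2 ` S K\<^sub>2"
    proof
      fix e assume "e \<in> (`) \<tau>\<^sub>1 ` S (X \<inter> K\<^sub>2)"
      then obtain d where d: "e = \<tau>\<^sub>1 ` d" "d \<in> S (X \<inter> K\<^sub>2)" by auto
      then have "e = \<tau>\<^sub>2 ` d" "d \<in> S K\<^sub>2"
        using gluing_maps_image_eq[OF g LV X, of d] by (auto simp: S_def)
      then show "e \<in> (`) \<tau>\<^sub>2 ` S K\<^sub>2" by blast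
    qed
    moreover have "{e \<in> S K\<^sub>2. e \<subseteq> L} = S K\<^sub>2" using right(2) by (auto simp: S_def)
    ultimately have K: "{e \<in> hedges (frame k M'). e \<subseteq> K} = (`) \<tau>\<^sub>2 ` S K\<^sub>2"
      using edges[of "{}" K\<^sub>2] right by auto
    show ?thesis
      unfolding svec_spanned K unfolding right(3) by (rule thick2[OF right(1,2) order_refl])
  next
    case (both K\<^sub>1 K\<^sub>2)
    note K1V = sub[OF both(1)]
    have XV: "X \<subseteq> V" using X LV by auto
    have "K\<^sub>1 \<union> X \<inter> K\<^sub>2 = K\<^sub>1" "K\<^sub>2 \<union> X \<inter> K\<^sub>1 = K\<^sub>2" "{e \<in> S K\<^sub>2. e \<subseteq> L} = S K\<^sub>2"
      using both by (auto simp: S_def)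
    then have "{e \<in> hedges (frame k M'). e \<subseteq> K} = (`) \<tau>\<^sub>1 ` S K\<^sub>1 \<union> (`) \<tau>\<^sub>2 ` S K\<^sub>2"
      using edges[OF K1V both(3)] both(6) by simp
    \<comment> \<open>The frame edges common to both halves are those inside \<open>X\<close>;
      inclusion-exclusion subtracts them once, which produces the correction term for
      \<open>X\<close>.\<close>
    moreover have "(`) \<tau>\<^sub>1 ` S K\<^sub>1 \<inter> (`) \<tau>\<^sub>2 ` S K\<^sub>2 = (`) \<tau>\<^sub>1 ` S X"
    proof (intro subset_antisym subsetI)
      fix u assume "u \<in> (`) \<tau>\<^sub>1 ` S K\<^sub>1 \<inter> (`) \<tau>\<^sub>2 ` S K\<^sub>2"
      then obtain d e where u: "d \<in> S K\<^sub>1" "e \<in> S K\<^sub>2" "u = \<tau>\<^sub>1 ` d" "u = \<tau>\<^sub>2 ` e" by blast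
      then have "d \<subseteq> V" "e \<subseteq> L" using K1V both(3) by (auto simp: S_def)
      then have "d \<subseteq> X"
        using gluing_maps_image_subset_iff(1)[OF g LV X, of "{}" e d] u(3,4) by auto
      then show "u \<in> (`) \<tau>\<^sub>1 ` S X" using u(1,3) by (simp add: S_def)
    next
      fix u assume "u \<in> (`) \<tau>\<^sub>1 ` S X"
      then obtain e where e: "u = \<tau>\<^sub>1 ` e" "e \<in> S X" by blast
      then have "e \<in> S K\<^sub>1" "e \<in> S K\<^sub>2" "u = \<tau>\<^sub>2 ` e"
        using both gluing_maps_image_eq[OF g LV X, of e] by (auto simp: S_def)
      then show "u \<in> (`) \<tau>\<^sub>1 ` S K\<^sub>1 \<inter> (`) \<tau>\<^sub>2 ` S K\<^sub>2" using e(1) by blast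
    qed
    moreover have fin: "finite (S A)" for A using E(2) by (simp add: S_def)
    ultimately have sum: "(\<Sum>e | e \<in> hedges (frame k M') \<and> e \<subseteq> K. ind e)
        = (\<Sum>e\<in>(`) \<tau>\<^sub>1 ` S K\<^sub>1. ind e) + (\<Sum>e\<in>(`) \<tau>\<^sub>2 ` S K\<^sub>2. ind e) - (\<Sum>e\<in>(`) \<tau>\<^sub>1 ` S X. ind e)"
      using sum.union_inter[of "(`) \<tau>\<^sub>1 ` S K\<^sub>1" "(`) \<tau>\<^sub>2 ` S K\<^sub>2" ind] by (simp add: eq_diff_eq)
    \<comment> \<open>Here the condition that the edges spanned by \<open>X\<close> are disjoint
      enters.\<close>
    have "ind X - (\<Sum>e\<in>S X. ind e) \<in> Q_cone X"
      using Z_hypergraph_in_Q_cone[OF reflect.hyps(3) order_refl] by (simp add: S_def E_def)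
    then have "push \<tau>\<^sub>1 V (ind X - (\<Sum>e\<in>S X. ind e)) \<in> Q_cone K"
      using both by (intro push_in_Q_cone[OF inj(1) XV]) auto
    moreover have "\<Union>(S X) \<subseteq> V" using XV by (auto simp: S_def)
    ultimately have "ind (\<tau>\<^sub>1 ` X) - (\<Sum>e\<in>(`) \<tau>\<^sub>1 ` S X. ind e) \<in> Q_cone K"
      using inj XV by (simp add: linear_diff[OF linear_push] push_ind push_sum_ind)
    then have 3: "ind (\<tau>\<^sub>1 ` X) - (\<Sum>e\<in>(`) \<tau>\<^sub>1 ` S X. ind e) \<in> thick_cone (brel M') K"
      by (rule subsetD[OF Q_cone_subset_thick_cone])
    have "(\<tau>\<^sub>1 ` K\<^sub>1, \<tau>\<^sub>2 ` K\<^sub>2) \<in> brel M'"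
      using both by (auto simp: M' reflection_def)
    then have 4: "- tvec (\<tau>\<^sub>1 ` K\<^sub>1) (\<tau>\<^sub>2 ` K\<^sub>2) \<in> thick_cone (brel M') K"
      using both by (intro uminus_tvec_in_thick_cone) auto
    have "tvec (\<tau>\<^sub>1 ` K\<^sub>1) (\<tau>\<^sub>2 ` K\<^sub>2) = ind K - ind (\<tau>\<^sub>1 ` K\<^sub>1) - ind (\<tau>\<^sub>2 ` K\<^sub>2) + ind (\<tau>\<^sub>1 ` X)"
      using gluing_maps_image_Int[OF g LV K1V both(3-5)] both(6) by (simp add: tvec_def)
    then have "svec (spanned (frame k M') K) =
        (- ind (\<tau>\<^sub>1 ` K\<^sub>1) + (\<Sum>e\<in>(`) \<tau>\<^sub>1 ` S K\<^sub>1. ind e))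
        + (- ind (\<tau>\<^sub>2 ` K\<^sub>2) + (\<Sum>e\<in>(`) \<tau>\<^sub>2 ` S K\<^sub>2. ind e))
        + (ind (\<tau>\<^sub>1 ` X) - (\<Sum>e\<in>(`) \<tau>\<^sub>1 ` S X. ind e)) + (- tvec (\<tau>\<^sub>1 ` K\<^sub>1) (\<tau>\<^sub>2 ` K\<^sub>2))"
      unfolding svec_spanned sum by (simp add: algebra_simps)
    then show ?thesis
      using thick1[OF both(1), of K] thick2[OF both(2,3), of K] 3 4 both(6)
      by (simp only: thick_cone_add sup_ge1 sup_ge2)
  qed
qed

lemma C_complex_weakly_thick:
  assumes "M \<in> C_complexes k"
  shows "weakly_thick_complex k M"
proof -
  have M: "M \<in> reflection_complexes k"
    using assms by (rule C_complex_imp_reflection_complex)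
  have b: "bedges M \<subseteq> Pow (bverts M)" "brel M \<subseteq> Pow (bverts M) \<times> Pow (bverts M)"
    using is_b_hypergraph_reflection_complex[OF M] by (auto simp: is_b_hypergraph_def)
  have "spanned (frame k M) (bverts M) = frame k M"
    using b(1) by (auto simp: spanned_def frame_def)
  then have "svec (frame k M) \<in> thick_cone (brel M) (bverts M)"
    using svec_spanned_in_thick_cone[OF assms reflection_complex_edges(1)[OF M]] by simp
  moreover have "brel M \<inter> Pow (bverts M) \<times> Pow (bverts M) = brel M" using b(2) by auto
  ultimately show ?thesis
    by (auto simp: weakly_thick_complex_def thick_cone_def)
qed

subsection \<open>Relative entropy of marginals\<close>

lemma sum_PiE_restrict:
  assumes "finite T" "finite W" "R \<subseteq> S" "S \<subseteq> T"
  shows "(\<Sum>g | g \<in> T \<rightarrow>\<^sub>E W \<and> (\<forall>v\<in>R. g v = f v). \<phi> g) =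
    (\<Sum>a | a \<in> S \<rightarrow>\<^sub>E W \<and> (\<forall>v\<in>R. a v = f v). \<Sum>g | g \<in> T \<rightarrow>\<^sub>E W \<and> (\<forall>v\<in>S. g v = a v). \<phi> g)"
    (is "sum \<phi> ?T = (\<Sum>a\<in>?S. _)")
proof -
  have fin: "finite ?T" "finite ?S"
    using assms by (auto intro!: finite_PiE intro: finite_subset)
  \<comment> \<open>The maps on \<open>T\<close> are grouped by their restriction to
    \<open>S\<close>; the prescribed values on \<open>R\<close> are visible in that
    restriction.\<close>
  have "(\<lambda>g. restrict g S) ` ?T \<subseteq> ?S" using assms by fastforce
  then have "sum \<phi> ?T = (\<Sum>a\<in>?S. \<Sum>g | g \<in> ?T \<and> restrict g S = a. \<phi> g)"
    by (rule sum.group[OF fin, symmetric])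
  also have "\<dots> = (\<Sum>a\<in>?S. \<Sum>g | g \<in> T \<rightarrow>\<^sub>E W \<and> (\<forall>v\<in>S. g v = a v). \<phi> g)"
  proof (rule sum.cong[OF refl])
    fix a assume a: "a \<in> ?S"
    have "restrict g S = a \<longleftrightarrow> (\<forall>v\<in>S. g v = a v)" for g
      using a PiE_arb[of a S] by (auto simp: fun_eq_iff restrict_def)
    then show "(\<Sum>g | g \<in> ?T \<and> restrict g S = a. \<phi> g) = (\<Sum>g | g \<in> T \<rightarrow>\<^sub>E W \<and> (\<forall>v\<in>S. g v = a v). \<phi> g)"
      using a assms(3) by (intro sum.cong) auto
  qed
  finally show ?thesis .
qed

text \<open>Change of variables: renaming the vertices along an injection is a bijection of the map
  spaces. The restrictions restore the default value outside the domain.\<close>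

lemma sum_PiE_image:
  assumes i: "inj_on \<tau> S" and A: "A \<subseteq> S"
  shows "(\<Sum>G | G \<in> \<tau> ` S \<rightarrow>\<^sub>E W \<and> (\<forall>v\<in>\<tau> ` A. G v = F v). \<phi> (restrict (G \<circ> \<tau>) S)) =
    (\<Sum>g | g \<in> S \<rightarrow>\<^sub>E W \<and> (\<forall>v\<in>A. g v = F (\<tau> v)). \<phi> g)"
proof (rule sum.reindex_bij_witness[where j = "\<lambda>G. restrict (G \<circ> \<tau>) S"
      and i = "\<lambda>g. restrict (g \<circ> inv_into S \<tau>) (\<tau> ` S)"])
  fix G assume G: "G \<in> {G \<in> \<tau> ` S \<rightarrow>\<^sub>E W. \<forall>v\<in>\<tau> ` A. G v = F v}"
  show "restrict (restrict (G \<circ> \<tau>) S \<circ> inv_into S \<tau>) (\<tau> ` S) = G"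
  proof
    fix x show "restrict (restrict (G \<circ> \<tau>) S \<circ> inv_into S \<tau>) (\<tau> ` S) x = G x"
      using i G PiE_arb[of G "\<tau> ` S" "\<lambda>_. W" x] by (cases "x \<in> \<tau> ` S") auto
  qed
  show "restrict (G \<circ> \<tau>) S \<in> {g \<in> S \<rightarrow>\<^sub>E W. \<forall>v\<in>A. g v = F (\<tau> v)}"
    using G A by auto
  show "\<phi> (restrict (G \<circ> \<tau>) S) = \<phi> (restrict (G \<circ> \<tau>) S)" ..
next
  fix g assume g: "g \<in> {g \<in> S \<rightarrow>\<^sub>E W. \<forall>v\<in>A. g v = F (\<tau> v)}"
  then show "restrict (restrict (g \<circ> inv_into S \<tau>) (\<tau> ` S) \<circ> \<tau>) S = g"
    using i PiE_arb[of g] by (auto simp: fun_eq_iff restrict_def)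
  have "g (inv_into S \<tau> (\<tau> v)) = g v" if "v \<in> S" for v
    using i that by simp
  note inv = this
  have "restrict (g \<circ> inv_into S \<tau>) (\<tau> ` S) \<in> \<tau> ` S \<rightarrow>\<^sub>E W"
    using g inv by auto
  moreover have "restrict (g \<circ> inv_into S \<tau>) (\<tau> ` S) (\<tau> v) = F (\<tau> v)" if "v \<in> A" for v
    using g A inv[of v] that by auto
  ultimately show "restrict (g \<circ> inv_into S \<tau>) (\<tau> ` S) \<in> {G \<in> \<tau> ` S \<rightarrow>\<^sub>E W. \<forall>v\<in>\<tau> ` A. G v = F v}"
    by blast
qed

text \<open>Once the values on \<open>A\<close> are fixed, a map on \<open>A \<union> C\<close> is
  determined by its restriction to \<open>C\<close>, which has to match \<open>a\<close> on the
  overlap.\<close>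

lemma sum_PiE_Un:
  assumes a: "a \<in> A \<rightarrow> W"
  shows "(\<Sum>g | g \<in> A \<union> C \<rightarrow>\<^sub>E W \<and> (\<forall>v\<in>A. g v = a v). \<phi> (restrict g C)) =
    (\<Sum>c | c \<in> C \<rightarrow>\<^sub>E W \<and> (\<forall>v\<in>A \<inter> C. c v = a v). \<phi> c)"
proof (rule sum.reindex_bij_witness[where j = "\<lambda>g. restrict g C"
      and i = "\<lambda>c. \<lambda>v\<in>A \<union> C. if v \<in> C then c v else a v"])
  fix g assume g: "g \<in> {g \<in> A \<union> C \<rightarrow>\<^sub>E W. \<forall>v\<in>A. g v = a v}"
  then show "(\<lambda>v\<in>A \<union> C. if v \<in> C then restrict g C v else a v) = g"
    using PiE_arb[of g] by (auto simp: fun_eq_iff restrict_def)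
  show "restrict g C \<in> {c \<in> C \<rightarrow>\<^sub>E W. \<forall>v\<in>A \<inter> C. c v = a v}"
    using g by auto
  show "\<phi> (restrict g C) = \<phi> (restrict g C)" ..
next
  fix c assume c: "c \<in> {c \<in> C \<rightarrow>\<^sub>E W. \<forall>v\<in>A \<inter> C. c v = a v}"
  then show "restrict (\<lambda>v\<in>A \<union> C. if v \<in> C then c v else a v) C = c"
    using PiE_arb[of c] by (auto simp: fun_eq_iff restrict_def)
  show "(\<lambda>v\<in>A \<union> C. if v \<in> C then c v else a v) \<in> {g \<in> A \<union> C \<rightarrow>\<^sub>E W. \<forall>v\<in>A. g v = a v}"
    using c a by auto
qed

text \<open>Nonnegativity of relative entropy, termwise from \<open>ln x \<le> x - 1\<close>. It
  suffices that \<open>q\<close> has total mass at most 1, which is the form available for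
  supermodularity.\<close>

lemma gibbs_inequality:
  fixes p q :: "'a \<Rightarrow> real"
  assumes "\<And>i. i \<in> I \<Longrightarrow> 0 \<le> p i" "\<And>i. i \<in> I \<Longrightarrow> 0 \<le> q i"
    and pos: "\<And>i. i \<in> I \<Longrightarrow> 0 < p i \<Longrightarrow> 0 < q i"
    and sums: "sum p I = 1" "sum q I \<le> 1"
  shows "0 \<le> (\<Sum>i\<in>I. p i * ln (p i / q i))"
proof -
  have "p i - q i \<le> p i * ln (p i / q i)" if "i \<in> I" for i
  \<comment> \<open>A term with \<open>p i = 0\<close> is 0 whatever value the logarithm
    takes.\<close>
  proof (cases "p i = 0")
    case False
    then have p: "0 < p i" "0 < q i" using assms(1)[OF that] pos[OF that] by auto
    then have "ln (q i / p i) \<le> q i / p i - 1" by (intro ln_le_minus_one) simp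
    then have "p i * ln (q i / p i) \<le> p i * (q i / p i - 1)" using p by (intro mult_left_mono) auto
    then show ?thesis using p by (simp add: ln_div algebra_simps)
  qed (use assms(2)[OF that] in simp)
  then have "(\<Sum>i\<in>I. p i - q i) \<le> (\<Sum>i\<in>I. p i * ln (p i / q i))" by (rule sum_mono)
  then show ?thesis using sums by (simp add: sum_subtractf)
qed

text \<open>Each marginal takes a whole map and looks at it on \<open>S\<close> only, so marginals
  on different sets can be multiplied and compared at one \<open>f\<close>.\<close>

definition marginal ::
    "'v set \<Rightarrow> 'b set \<Rightarrow> (('v \<Rightarrow> 'b) \<Rightarrow> real) \<Rightarrow> 'v set \<Rightarrow> ('v \<Rightarrow> 'b) \<Rightarrow> real" where
  "marginal V W P S f = (\<Sum>g | g \<in> V \<rightarrow>\<^sub>E W \<and> (\<forall>v\<in>S. g v = f v). P g)"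

lemma marginal_cong: "(\<And>v. v \<in> S \<Longrightarrow> f v = g v) \<Longrightarrow> marginal V W P S f = marginal V W P S g"
  by (simp add: marginal_def)

lemma sum_marginal:
  assumes "finite V" "finite W" "R \<subseteq> S" "S \<subseteq> V"
  shows "(\<Sum>a | a \<in> S \<rightarrow>\<^sub>E W \<and> (\<forall>v\<in>R. a v = f v). marginal V W P S a) = marginal V W P R f"
  unfolding marginal_def using assms by (rule sum_PiE_restrict[symmetric])

locale joint_distribution =
  fixes V :: "'v set" and W :: "'b set" and P :: "('v \<Rightarrow> 'b) \<Rightarrow> real"
  assumes finite_V: "finite V" and finite_W: "finite W"
    and P_nonneg: "f \<in> V \<rightarrow>\<^sub>E W \<Longrightarrow> 0 \<le> P f"
    and sum_P: "(\<Sum>f\<in>V \<rightarrow>\<^sub>E W. P f) = 1"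
begin

abbreviation m :: "'v set \<Rightarrow> ('v \<Rightarrow> 'b) \<Rightarrow> real" where "m \<equiv> marginal V W P"

text \<open>The relative entropy of the marginal on \<open>S\<close> with respect to the uniform distribution.\<close>

definition rel_entropy :: "'v set \<Rightarrow> real" where
  "rel_entropy S = (\<Sum>f\<in>V \<rightarrow>\<^sub>E W. P f * ln (real (card W) ^ card S * m S f))"

section \<open>Marginals and expectations\<close>

lemma finite_maps: "finite (V \<rightarrow>\<^sub>E W)"
  using finite_V finite_W by (intro finite_PiE) auto

lemma marginal_nonneg: "0 \<le> m S f"
  unfolding marginal_def by (rule sum_nonneg) (auto intro: P_nonneg)

lemma marginal_antimono: "S \<subseteq> T \<Longrightarrow> m T f \<le> m S f"
  unfolding marginal_def
  by (rule sum_mono2) (auto intro: P_nonneg finite_subset[OF _ finite_maps])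

lemma marginal_empty: "m {} f = 1"
  using sum_P by (simp add: marginal_def)

lemma marginal_full:
  assumes "f \<in> V \<rightarrow>\<^sub>E W"
  shows "m V f = P f"
proof -
  have "{g \<in> V \<rightarrow>\<^sub>E W. \<forall>v\<in>V. g v = f v} = {f}"
    using assms by (auto intro: PiE_ext)
  then show ?thesis by (simp add: marginal_def)
qed

lemma marginal_pos:
  assumes "f \<in> V \<rightarrow>\<^sub>E W" "0 < P f" "S \<subseteq> V"
  shows "0 < m S f"
  using marginal_antimono[OF assms(3), of f] assms marginal_full by simp

text \<open>Total mass 1 forces some map from \<open>V\<close> to \<open>W\<close> to exist; so
  \<open>W\<close> is nonempty or \<open>V\<close> is empty, and in the latter case the power is
  \<open>0 ^ 0 = 1\<close> at worst.\<close>

lemma card_power_pos: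
  assumes "S \<subseteq> V"
  shows "0 < real (card W) ^ card S"
proof -
  have "V \<rightarrow>\<^sub>E W \<noteq> {}" using sum_P by force
  then have "V = {} \<or> W \<noteq> {}" by (auto simp: PiE_eq_empty_iff)
  then show ?thesis using assms finite_W by (auto simp: card_gt_0_iff)
qed

text \<open>Turns expectations under \<open>P\<close> into sums over maps on \<open>S\<close>, where
  Gibbs' inequality can be applied to the marginal.\<close>

lemma expectation_marginal:
  assumes S: "S \<subseteq> V" and \<phi>: "\<And>f g. (\<And>v. v \<in> S \<Longrightarrow> f v = g v) \<Longrightarrow> \<phi> f = \<phi> g"
  shows "(\<Sum>f\<in>V \<rightarrow>\<^sub>E W. P f * \<phi> f) = (\<Sum>g\<in>S \<rightarrow>\<^sub>E W. m S g * \<phi> g)"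
proof -
  have "(\<Sum>f\<in>V \<rightarrow>\<^sub>E W. P f * \<phi> f)
      = (\<Sum>a\<in>S \<rightarrow>\<^sub>E W. \<Sum>g | g \<in> V \<rightarrow>\<^sub>E W \<and> (\<forall>v\<in>S. g v = a v). P g * \<phi> g)"
    using sum_PiE_restrict[OF finite_V finite_W, of "{}" S "\<lambda>f. P f * \<phi> f" undefined] S by simp
  also have "\<dots> = (\<Sum>a\<in>S \<rightarrow>\<^sub>E W. m S a * \<phi> a)"
  proof (rule sum.cong[OF refl])
    fix a
    have "(\<Sum>g | g \<in> V \<rightarrow>\<^sub>E W \<and> (\<forall>v\<in>S. g v = a v). P g * \<phi> g)
        = (\<Sum>g | g \<in> V \<rightarrow>\<^sub>E W \<and> (\<forall>v\<in>S. g v = a v). P g * \<phi> a)"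
      by (intro sum.cong refl) (metis (mono_tags, lifting) \<phi> mem_Collect_eq)
    then show "(\<Sum>g | g \<in> V \<rightarrow>\<^sub>E W \<and> (\<forall>v\<in>S. g v = a v). P g * \<phi> g) = m S a * \<phi> a"
      by (simp add: marginal_def sum_distrib_right)
  qed
  finally show ?thesis .
qed

lemma sum_marginal_1: "S \<subseteq> V \<Longrightarrow> (\<Sum>g\<in>S \<rightarrow>\<^sub>E W. m S g) = 1"
  using sum_marginal[OF finite_V finite_W, of "{}" S P undefined] marginal_empty by simp

lemma rel_entropy_empty: "rel_entropy {} = 0"
  by (simp add: rel_entropy_def marginal_empty)

lemma rel_entropy_nonneg:
  assumes S: "S \<subseteq> V"
  shows "0 \<le> rel_entropy S"
proof -
  let ?c = "real (card W) ^ card S"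
  note c = card_power_pos[OF S]
  have "rel_entropy S = (\<Sum>g\<in>S \<rightarrow>\<^sub>E W. m S g * ln (?c * m S g))"
    unfolding rel_entropy_def
    by (intro expectation_marginal[OF S] arg_cong[where f = ln] arg_cong2[where f = times] refl
        marginal_cong)
  \<comment> \<open>\<open>1 / ?c\<close> is the uniform density on the maps from \<open>S\<close>
    to \<open>W\<close>.\<close>
  also have "\<dots> = (\<Sum>g\<in>S \<rightarrow>\<^sub>E W. m S g * ln (m S g / (1 / ?c)))"
    by (simp add: mult.commute)
  also have "0 \<le> \<dots>"
  proof (rule gibbs_inequality)
    have "card (S \<rightarrow>\<^sub>E W) = card W ^ card S"
      using finite_subset[OF S finite_V] by (rule card_funcsetE)
    then show "(\<Sum>g\<in>S \<rightarrow>\<^sub>E W. 1 / ?c) \<le> 1" by simp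
  qed (use c marginal_nonneg sum_marginal_1[OF S] in auto)
  finally show ?thesis .
qed

text \<open>The summand is the law that glues the marginals on \<open>A\<close> and \<open>C\<close>
  independently given the intersection. Summing over extensions of \<open>a\<close> from
  \<open>A\<close> replaces \<open>m C\<close> by the marginal on the intersection, which
  cancels.\<close>

lemma sum_marginal_quotient_le:
  assumes A: "A \<subseteq> V" and C: "C \<subseteq> V"
  shows "(\<Sum>g\<in>A \<union> C \<rightarrow>\<^sub>E W. m A g * m C g / m (A \<inter> C) g) \<le> 1"
proof -
  have fin: "finite (A \<union> C)" using assms finite_V by (auto intro: finite_subset)
  have "(\<Sum>g\<in>A \<union> C \<rightarrow>\<^sub>E W. m A g * m C g / m (A \<inter> C) g) =
    (\<Sum>a\<in>A \<rightarrow>\<^sub>E W. \<Sum>g | g \<in> A \<union> C \<rightarrow>\<^sub>E W \<and> (\<forall>v\<in>A. g v = a v). m A g * m C g / m (A \<inter> C) g)"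
    using sum_PiE_restrict[OF fin finite_W, of "{}" A _ undefined] by simp
  also have "\<dots> = (\<Sum>a\<in>A \<rightarrow>\<^sub>E W. m A a / m (A \<inter> C) a * m (A \<inter> C) a)"
  proof (rule sum.cong[OF refl])
    fix a assume a: "a \<in> A \<rightarrow>\<^sub>E W"
    have "(\<Sum>g | g \<in> A \<union> C \<rightarrow>\<^sub>E W \<and> (\<forall>v\<in>A. g v = a v). m A g * m C g / m (A \<inter> C) g)
        = (\<Sum>g | g \<in> A \<union> C \<rightarrow>\<^sub>E W \<and> (\<forall>v\<in>A. g v = a v).
            m A a / m (A \<inter> C) a * m C (restrict g C))"
    proof (rule sum.cong[OF refl])
      fix g assume "g \<in> {g \<in> A \<union> C \<rightarrow>\<^sub>E W. \<forall>v\<in>A. g v = a v}"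
      then have "m A g = m A a" "m (A \<inter> C) g = m (A \<inter> C) a" "m C (restrict g C) = m C g"
        by (auto intro!: marginal_cong)
      then show "m A g * m C g / m (A \<inter> C) g = m A a / m (A \<inter> C) a * m C (restrict g C)"
        by simp
    qed
    also have "\<dots> = m A a / m (A \<inter> C) a *
        (\<Sum>c | c \<in> C \<rightarrow>\<^sub>E W \<and> (\<forall>v\<in>A \<inter> C. c v = a v). m C c)"
    proof -
      have "a \<in> A \<rightarrow> W" using a by (simp add: PiE_def)
      then show ?thesis unfolding sum_distrib_left[symmetric] by (simp only: sum_PiE_Un)
    qed
    also have "\<dots> = m A a / m (A \<inter> C) a * m (A \<inter> C) a"
      using sum_marginal[OF finite_V finite_W, of "A \<inter> C" C] C by simp
    finally show "(\<Sum>g | g \<in> A \<union> C \<rightarrow>\<^sub>E W \<and> (\<forall>v\<in>A. g v = a v). m A g * m C g / m (A \<inter> C) g)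
        = m A a / m (A \<inter> C) a * m (A \<inter> C) a" .
  qed
  \<comment> \<open>If the denominator is 0, the quotient is 0 by convention, and an inequality is
    enough.\<close>
  also have "\<dots> \<le> (\<Sum>a\<in>A \<rightarrow>\<^sub>E W. m A a)"
    using marginal_nonneg by (intro sum_mono) simp
  finally show ?thesis using sum_marginal_1[OF A] by simp
qed

text \<open>The powers of \<open>card W\<close> cancel since \<open>card A + card C\<close> is the
  sum of the cardinalities of union and intersection. What remains is the conditional mutual
  information of \<open>A\<close> and \<open>C\<close> given their intersection.\<close>

lemma rel_entropy_combination:
  assumes A: "A \<subseteq> V" and C: "C \<subseteq> V"
  shows "rel_entropy (A \<union> C) - rel_entropy A - rel_entropy C + rel_entropy (A \<inter> C)
    = (\<Sum>f\<in>V \<rightarrow>\<^sub>E W. P f * ln (m (A \<union> C) f * m (A \<inter> C) f / (m A f * m C f)))"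
proof -
  let ?n = "\<lambda>S. real (card W) ^ card S"
  have sub: "A \<union> C \<subseteq> V" "A \<inter> C \<subseteq> V" using assms by auto
  have "card A + card C = card (A \<union> C) + card (A \<inter> C)"
    using assms finite_V by (intro card_Un_Int) (auto intro: finite_subset)
  then have n: "?n (A \<union> C) * ?n (A \<inter> C) = ?n A * ?n C" by (metis power_add)
  have "P f * ln (?n (A \<union> C) * m (A \<union> C) f) - P f * ln (?n A * m A f) - P f * ln (?n C * m C f)
      + P f * ln (?n (A \<inter> C) * m (A \<inter> C) f)
      = P f * ln (m (A \<union> C) f * m (A \<inter> C) f / (m A f * m C f))" if f: "f \<in> V \<rightarrow>\<^sub>E W" for f
  proof (cases "P f = 0")
    case False
    then have "0 < P f" using P_nonneg[OF f] by simp
    note p = marginal_pos[OF f this]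
    have "ln (?n (A \<union> C)) + ln (?n (A \<inter> C)) = ln (?n A) + ln (?n C)"
      using card_power_pos[OF A] card_power_pos[OF C] card_power_pos[OF sub(1)]
        card_power_pos[OF sub(2)] n by (metis ln_mult_pos)
    then have "ln (?n (A \<union> C) * m (A \<union> C) f) - ln (?n A * m A f) - ln (?n C * m C f)
      + ln (?n (A \<inter> C) * m (A \<inter> C) f) = ln (m (A \<union> C) f * m (A \<inter> C) f / (m A f * m C f))"
      using p[OF A] p[OF C] p[OF sub(1)] p[OF sub(2)] card_power_pos[OF A] card_power_pos[OF C]
        card_power_pos[OF sub(1)] card_power_pos[OF sub(2)]
      by (simp add: ln_mult_pos ln_div)
    from this[symmetric] show ?thesis by (simp only: distrib_left right_diff_distrib)
  qed simp
  then show ?thesis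
    unfolding rel_entropy_def
    by (simp add: sum.distrib[symmetric] sum_subtractf[symmetric])
qed

text \<open>Gibbs' inequality for the marginal on the union against the conditionally independent
  gluing \<open>?q\<close>.\<close>

lemma rel_entropy_superadditive:
  assumes A: "A \<subseteq> V" and C: "C \<subseteq> V"
  shows "0 \<le> rel_entropy (A \<union> C) - rel_entropy A - rel_entropy C + rel_entropy (A \<inter> C)"
proof -
  have AC: "A \<union> C \<subseteq> V" using assms by auto
  let ?q = "\<lambda>g. m A g * m C g / m (A \<inter> C) g"
  have "(\<Sum>f\<in>V \<rightarrow>\<^sub>E W. P f * ln (m (A \<union> C) f * m (A \<inter> C) f / (m A f * m C f)))
      = (\<Sum>f\<in>V \<rightarrow>\<^sub>E W. P f * ln (m (A \<union> C) f / ?q f))"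
    by simp
  also have "\<dots> = (\<Sum>g\<in>A \<union> C \<rightarrow>\<^sub>E W. m (A \<union> C) g * ln (m (A \<union> C) g / ?q g))"
    by (intro expectation_marginal[OF AC] arg_cong[where f = ln] arg_cong2[where f = times]
        arg_cong2[where f = divide] marginal_cong) auto
  also have "0 \<le> \<dots>"
  proof (rule gibbs_inequality)
    fix g assume "0 < m (A \<union> C) g"
    then have "0 < m A g" "0 < m C g" "0 < m (A \<inter> C) g"
      using marginal_antimono[of A "A \<union> C" g] marginal_antimono[of C "A \<union> C" g]
        marginal_antimono[of "A \<inter> C" A g] by auto
    then show "0 < ?q g" by simp
  qed (use marginal_nonneg sum_marginal_1[OF AC] sum_marginal_quotient_le[OF A C] in auto)
  finally show ?thesis unfolding rel_entropy_combination[OF A C] .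
qed

text \<open>The logarithm is taken of \<open>x / x\<close>, which is 1 or, for \<open>x = 0\<close>,
  the default 0; \<open>ln\<close> vanishes at both.\<close>

lemma rel_entropy_independent:
  assumes "A \<subseteq> V" "C \<subseteq> V"
    and ind: "\<And>f. m (A \<union> C) f * m (A \<inter> C) f = m A f * m C f"
  shows "rel_entropy (A \<union> C) - rel_entropy A - rel_entropy C + rel_entropy (A \<inter> C) = 0"
  unfolding rel_entropy_combination[OF assms(1,2)] ind
  by (intro sum.neutral) (auto simp: divide_self_if)

text \<open>Gibbs' inequality against the uniform distribution on \<open>T\<close>: a distribution
  supported in \<open>T\<close> has entropy at most \<open>ln (card T)\<close>.\<close>

lemma rel_entropy_support:
  assumes T: "\<And>f. f \<in> V \<rightarrow>\<^sub>E W \<Longrightarrow> 0 < P f \<Longrightarrow> f \<in> T" and sub: "T \<subseteq> V \<rightarrow>\<^sub>E W"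
  shows "0 < card T" "ln (real (card W) ^ card V / real (card T)) \<le> rel_entropy V"
proof -
  have fin: "finite T" using finite_subset[OF sub finite_maps] .
  have "\<exists>f\<in>V \<rightarrow>\<^sub>E W. P f \<noteq> 0"
    using sum_P by (metis sum.neutral zero_neq_one)
  then have "T \<noteq> {}" using T P_nonneg by force
  then show t: "0 < card T" using fin by (simp add: card_gt_0_iff)
  let ?q = "\<lambda>f. if f \<in> T then 1 / real (card T) else 0"
  have "(\<Sum>f\<in>V \<rightarrow>\<^sub>E W. ?q f) = 1"
    using sub finite_maps t by (simp add: sum.If_cases Int_absorb1)
  then have "0 \<le> (\<Sum>f\<in>V \<rightarrow>\<^sub>E W. P f * ln (P f / ?q f))"
    using t T by (intro gibbs_inequality P_nonneg sum_P) auto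
  also have "\<dots> = (\<Sum>f\<in>V \<rightarrow>\<^sub>E W. P f * ln (real (card W) ^ card V * m V f)
      - P f * ln (real (card W) ^ card V / real (card T)))"
  proof (rule sum.cong[OF refl])
    fix f assume f: "f \<in> V \<rightarrow>\<^sub>E W"
    show "P f * ln (P f / ?q f) = P f * ln (real (card W) ^ card V * m V f)
      - P f * ln (real (card W) ^ card V / real (card T))"
    proof (cases "P f = 0")
      case False
      then have p: "0 < P f" using P_nonneg[OF f] by simp
      then have "f \<in> T" using T f by blast
      then have "ln (P f / ?q f) = ln (real (card W) ^ card V * m V f)
          - ln (real (card W) ^ card V / real (card T))"
        using p t card_power_pos[OF order_refl] marginal_full[OF f]
        by (simp add: ln_mult_pos ln_div)
      then show ?thesis by (simp add: right_diff_distrib)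
    qed simp
  qed
  also have "\<dots> = rel_entropy V - ln (real (card W) ^ card V / real (card T))"
    using sum_P by (simp add: sum_subtractf rel_entropy_def flip: sum_distrib_right)
  finally show "ln (real (card W) ^ card V / real (card T)) \<le> rel_entropy V" by simp
qed

text \<open>Extend \<open>rel_entropy\<close> to a linear functional on set functions and apply it
  to both sides of the decomposition of \<open>svec H\<close>.\<close>

lemma rel_entropy_weakly_thick:
  assumes B: "B \<subseteq> Pow V \<times> Pow V"
    and ind: "\<And>A C f. (A, C) \<in> B \<Longrightarrow> m (A \<union> C) f * m (A \<inter> C) f = m A f * m C f"
    and x: "svec H = w + q" "w \<in> W_space B" "q \<in> Q_cone V"
    and H: "hverts H = V" "hedges H \<subseteq> Pow V"
  shows "rel_entropy V \<le> (\<Sum>e\<in>hedges H. rel_entropy e)"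
proof -
  define \<Phi> where "\<Phi> x = (\<Sum>S\<in>Pow V. x S * rel_entropy S)" for x
  have lin: "linear \<Phi>"
    by (rule linearI)
      (simp_all add: \<Phi>_def distrib_right sum.distrib scaleR_fun_def sum_distrib_left mult.assoc)
  have \<Phi>_ind: "\<Phi> (ind S) = rel_entropy S" if "S \<subseteq> V" for S
  proof -
    have "\<Phi> (ind S) = (\<Sum>T\<in>Pow V. if T = S then rel_entropy T else 0)"
      unfolding \<Phi>_def ind_def by (intro sum.cong) auto
    then show ?thesis using that finite_V by simp
  qed
  have \<Phi>_tvec: "\<Phi> (tvec A C) =
      rel_entropy (A \<union> C) - rel_entropy A - rel_entropy C + rel_entropy (A \<inter> C)"
    if "A \<subseteq> V" "C \<subseteq> V" for A C
  proof -
    have "A \<union> C \<subseteq> V" "A \<inter> C \<subseteq> V" using that by auto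
    then show ?thesis
      using that by (simp add: tvec_def linear_add[OF lin] linear_diff[OF lin] \<Phi>_ind)
  qed
  have "\<Phi> w = 0"
    using x(2) unfolding W_space_def
  proof (rule linear_eq_0_on_span[OF lin, rotated])
    fix y assume "y \<in> {tvec A C |A C. (A, C) \<in> B}"
    then obtain A C where y: "y = tvec A C" "(A, C) \<in> B" by auto
    then have "A \<subseteq> V" "C \<subseteq> V" using B by auto
    then show "\<Phi> y = 0"
      unfolding y(1) by (simp only: \<Phi>_tvec rel_entropy_independent ind[OF y(2)])
  qed
  moreover have "0 \<le> \<Phi> q"
  proof -
    obtain c r where q: "q = c *\<^sub>R ind {} + r" and r: "r \<in> convex_cone hull Q_generators V"
      using x(3) by (auto simp: Q_cone_def)
    \<comment> \<open>The half-space is a convex cone, so checking the generators suffices.\<close>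
    have "convex_cone {y. 0 \<le> \<Phi> y}"
      by (auto simp: convex_cone_iff linear_0[OF lin] linear_add[OF lin] linear_scale[OF lin])
    moreover have "Q_generators V \<subseteq> {y. 0 \<le> \<Phi> y}"
      using \<Phi>_tvec rel_entropy_superadditive \<Phi>_ind rel_entropy_nonneg by auto
    ultimately have "convex_cone hull Q_generators V \<subseteq> {y. 0 \<le> \<Phi> y}"
      by (intro hull_minimal)
    then have "0 \<le> \<Phi> r" using r by auto
    then show ?thesis
      by (simp add: q linear_add[OF lin] linear_scale[OF lin] \<Phi>_ind rel_entropy_empty)
  qed
  moreover have "\<Phi> (svec H) = - rel_entropy V + (\<Sum>e\<in>hedges H. rel_entropy e)"
  proof -
    have "(\<Sum>e\<in>hedges H. \<Phi> (ind e)) = (\<Sum>e\<in>hedges H. rel_entropy e)"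
      using H(2) by (intro sum.cong) (auto simp: \<Phi>_ind)
    then show ?thesis
      unfolding svec_def H(1)
      by (simp only: linear_add[OF lin] linear_neg[OF lin] linear_sum[OF lin] \<Phi>_ind order_refl)
  qed
  ultimately show ?thesis using linear_add[OF lin, of w q] x(1) by simp
qed

text \<open>Given its values on \<open>X\<close>, the copy of \<open>L\<close> is drawn from the
  conditional law \<open>m L / m X\<close>, independently of the copy of \<open>V\<close>. Where
  \<open>m X\<close> is 0, the quotient is 0 by convention.\<close>

definition reflected :: "('v \<Rightarrow> 'w) \<Rightarrow> ('v \<Rightarrow> 'w) \<Rightarrow> 'v set \<Rightarrow> 'v set \<Rightarrow> ('w \<Rightarrow> 'b) \<Rightarrow> real" where
  "reflected \<tau>\<^sub>1 \<tau>\<^sub>2 L X F = P (restrict (F \<circ> \<tau>\<^sub>1) V) * m L (F \<circ> \<tau>\<^sub>2) / m X (F \<circ> \<tau>\<^sub>1)"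

section \<open>Marginals of the conditionally independent gluing\<close>

context
  fixes \<tau>\<^sub>1 \<tau>\<^sub>2 :: "'v \<Rightarrow> 'w" and L X :: "'v set"
  assumes g: "gluing_maps V L X \<tau>\<^sub>1 \<tau>\<^sub>2" and L: "L \<subseteq> V" and X: "X \<subseteq> L"
begin

abbreviation m' :: "'w set \<Rightarrow> ('w \<Rightarrow> 'b) \<Rightarrow> real" where
  "m' \<equiv> marginal (\<tau>\<^sub>1 ` V \<union> \<tau>\<^sub>2 ` L) W (reflected \<tau>\<^sub>1 \<tau>\<^sub>2 L X)"

text \<open>A map on the glued set is a pair of maps agreeing on \<open>X\<close>. As
  \<open>A\<close> and \<open>C\<close> contain \<open>X\<close>, prescribing \<open>F\<close> fixes
  the values there; the denominator becomes constant and the sum factors over the two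
  copies.\<close>

lemma marginal_reflected:
  assumes A: "X \<subseteq> A" "A \<subseteq> V" and C: "X \<subseteq> C" "C \<subseteq> L"
  shows "m' (\<tau>\<^sub>1 ` A \<union> \<tau>\<^sub>2 ` C) F = m A (F \<circ> \<tau>\<^sub>1) * m C (F \<circ> \<tau>\<^sub>2) / m X (F \<circ> \<tau>\<^sub>1)"
proof -
  define V' where "V' = \<tau>\<^sub>1 ` V \<union> \<tau>\<^sub>2 ` L"
  define S where "S = {G \<in> V' \<rightarrow>\<^sub>E W. \<forall>v\<in>\<tau>\<^sub>1 ` A \<union> \<tau>\<^sub>2 ` C. G v = F v}"
  define S1 where "S1 = {f \<in> V \<rightarrow>\<^sub>E W. \<forall>v\<in>A. f v = (F \<circ> \<tau>\<^sub>1) v}"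
  define S2 where "S2 = {f \<in> L \<rightarrow>\<^sub>E W. \<forall>v\<in>C. f v = (F \<circ> \<tau>\<^sub>2) v}"
  define j where "j G = (restrict (G \<circ> \<tau>\<^sub>1) V, restrict (G \<circ> \<tau>\<^sub>2) L)" for G :: "'w \<Rightarrow> 'b"
  define i :: "('v \<Rightarrow> 'b) \<times> ('v \<Rightarrow> 'b) \<Rightarrow> 'w \<Rightarrow> 'b" where
    "i = (\<lambda>(f, h). \<lambda>v\<in>V'. if v \<in> \<tau>\<^sub>1 ` V then f (inv_into V \<tau>\<^sub>1 v) else h (inv_into L \<tau>\<^sub>2 v))"
  note inj = gluing_maps_inj[OF g]
  have eqX: "\<tau>\<^sub>2 x = \<tau>\<^sub>1 x" if "x \<in> X" for x
    using gluing_maps_eq_iff[OF g, of x x] that X L by (metis subsetD)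
  have i1: "i (f, h) (\<tau>\<^sub>1 v) = f v" if "v \<in> V" for f h v
    using that inj by (simp add: i_def V'_def)
  \<comment> \<open>At an identified vertex \<open>i\<close> uses \<open>f\<close>; this agrees with
    \<open>h\<close> because both are prescribed by \<open>F\<close> there.\<close>
  have i2: "i (f, h) (\<tau>\<^sub>2 v) = h v" if "v \<in> L" "f \<in> S1" "h \<in> S2" for f h v
  proof (cases "\<tau>\<^sub>2 v \<in> \<tau>\<^sub>1 ` V")
    case True
    then have v: "v \<in> X" using gluing_maps_eq_iff[OF g] that(1) by fastforce
    then have "i (f, h) (\<tau>\<^sub>2 v) = f v" using i1[of v] eqX L X by auto
    also have "\<dots> = h v"
    proof -
      have "v \<in> A" "v \<in> C" using v A C by auto
      then show ?thesis using eqX[OF v] that(2,3) by (simp add: S1_def S2_def)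
    qed
    finally show ?thesis .
  qed (use that(1) inj in \<open>simp add: i_def V'_def\<close>)
  have "m' (\<tau>\<^sub>1 ` A \<union> \<tau>\<^sub>2 ` C) F = (\<Sum>G\<in>S. reflected \<tau>\<^sub>1 \<tau>\<^sub>2 L X G)"
    by (simp add: marginal_def S_def V'_def)
  also have "\<dots> = (\<Sum>(f, h)\<in>S1 \<times> S2. P f * m L h / m X (F \<circ> \<tau>\<^sub>1))"
  proof (rule sum.reindex_bij_witness[where j = j and i = i])
    fix G assume G: "G \<in> S"
    then have GE: "G \<in> V' \<rightarrow>\<^sub>E W" by (simp add: S_def)
    show "j G \<in> S1 \<times> S2"
      using G A C by (auto simp: j_def S_def S1_def S2_def V'_def intro!: PiE_mem[OF GE])
    show "i (j G) = G"
    proof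
      fix v show "i (j G) v = G v"
      proof (cases "v \<in> V'")
        case True
        then show ?thesis
          by (auto simp: i_def j_def V'_def inv_into_into f_inv_into_f)
      qed (use PiE_arb[OF GE] in \<open>simp add: i_def j_def\<close>)
    qed
    have "m L (restrict (G \<circ> \<tau>\<^sub>2) L) = m L (G \<circ> \<tau>\<^sub>2)"
      by (rule marginal_cong) simp
    moreover have "m X (G \<circ> \<tau>\<^sub>1) = m X (F \<circ> \<tau>\<^sub>1)"
      using G A by (intro marginal_cong) (auto simp: S_def)
    ultimately show "(case j G of (f, h) \<Rightarrow> P f * m L h / m X (F \<circ> \<tau>\<^sub>1)) = reflected \<tau>\<^sub>1 \<tau>\<^sub>2 L X G"
      by (simp add: j_def reflected_def)
  next
    fix b assume "b \<in> S1 \<times> S2"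
    then obtain f h where b: "b = (f, h)" and f: "f \<in> S1" and h: "h \<in> S2" by auto
    have fE: "f \<in> V \<rightarrow>\<^sub>E W" and hE: "h \<in> L \<rightarrow>\<^sub>E W" using f h by (auto simp: S1_def S2_def)
    show "j (i b) = b"
      using i1[of _ f h] i2[OF _ f h] PiE_arb[OF fE] PiE_arb[OF hE]
      by (auto simp: b j_def fun_eq_iff)
    have "i b \<in> V' \<rightarrow>\<^sub>E W"
    proof
      fix v assume "v \<in> V'"
      then show "i b v \<in> W"
        using i1[of _ f h] i2[OF _ f h] PiE_mem[OF fE] PiE_mem[OF hE] by (auto simp: b V'_def)
    qed (auto simp: b i_def)
    moreover have "i b v = F v" if "v \<in> \<tau>\<^sub>1 ` A \<union> \<tau>\<^sub>2 ` C" for v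
      using that i1[of _ f h] i2[OF _ f h] f h A C by (auto simp: b S1_def S2_def)
    ultimately show "i b \<in> S" by (simp add: S_def)
  qed
  also have "\<dots> = (\<Sum>f\<in>S1. P f) * (\<Sum>h\<in>S2. m L h) / m X (F \<circ> \<tau>\<^sub>1)"
    by (simp add: sum.cartesian_product[symmetric] sum_product sum_divide_distrib)
  also have "(\<Sum>f\<in>S1. P f) = m A (F \<circ> \<tau>\<^sub>1)"
    by (simp add: marginal_def S1_def)
  also have "(\<Sum>h\<in>S2. m L h) = m C (F \<circ> \<tau>\<^sub>2)"
    unfolding S2_def using C L by (intro sum_marginal finite_V finite_W)
  finally show ?thesis .
qed

lemma marginal_eq_0: "S \<subseteq> T \<Longrightarrow> m S f = 0 \<Longrightarrow> m T f = 0"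
  using marginal_antimono[of S T f] marginal_nonneg[of T f] by simp

lemma finite_reflected: "finite (\<tau>\<^sub>1 ` V \<union> \<tau>\<^sub>2 ` L)"
  using finite_V L by (auto intro: finite_subset)

text \<open>The first copy keeps the law \<open>P\<close>: choosing \<open>C = X\<close> in the
  product formula gives the marginal on all of \<open>V\<close>, and smaller sets follow by
  summation.\<close>

lemma marginal_reflected_left:
  assumes A: "A \<subseteq> V"
  shows "m' (\<tau>\<^sub>1 ` A) F = m A (F \<circ> \<tau>\<^sub>1)"
proof -
  have eq: "\<tau>\<^sub>1 ` V \<union> \<tau>\<^sub>2 ` X = \<tau>\<^sub>1 ` V"
    using gluing_maps_image_eq[OF g L X order_refl] X L by auto
  have "m' (\<tau>\<^sub>1 ` V) G = m V (restrict (G \<circ> \<tau>\<^sub>1) V)" for G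
  proof -
    have "m' (\<tau>\<^sub>1 ` V) G = m V (G \<circ> \<tau>\<^sub>1) * m X (G \<circ> \<tau>\<^sub>2) / m X (G \<circ> \<tau>\<^sub>1)"
      using marginal_reflected[of V X G] X L unfolding eq by simp
    also have "m X (G \<circ> \<tau>\<^sub>2) = m X (G \<circ> \<tau>\<^sub>1)"
      using gluing_maps_eq_iff[OF g] X L by (intro marginal_cong) (force simp: comp_def)
    \<comment> \<open>Cancellation survives a zero denominator, since \<open>m X = 0\<close> forces
      \<open>m V = 0\<close>.\<close>
    also have "m V (G \<circ> \<tau>\<^sub>1) * m X (G \<circ> \<tau>\<^sub>1) / m X (G \<circ> \<tau>\<^sub>1) = m V (G \<circ> \<tau>\<^sub>1)"
      using marginal_eq_0[of X V "G \<circ> \<tau>\<^sub>1"] X L by auto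
    also have "\<dots> = m V (restrict (G \<circ> \<tau>\<^sub>1) V)" by (rule marginal_cong) simp
    finally show ?thesis .
  qed
  then have "m' (\<tau>\<^sub>1 ` A) F = (\<Sum>G | G \<in> \<tau>\<^sub>1 ` V \<rightarrow>\<^sub>E W \<and> (\<forall>v\<in>\<tau>\<^sub>1 ` A. G v = F v).
      m V (restrict (G \<circ> \<tau>\<^sub>1) V))"
    using sum_marginal[OF finite_reflected finite_W, of "\<tau>\<^sub>1 ` A" "\<tau>\<^sub>1 ` V" "reflected \<tau>\<^sub>1 \<tau>\<^sub>2 L X" F] A
    by (simp add: image_mono)
  also have "\<dots> = (\<Sum>f | f \<in> V \<rightarrow>\<^sub>E W \<and> (\<forall>v\<in>A. f v = F (\<tau>\<^sub>1 v)). m V f)"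
    by (rule sum_PiE_image[OF gluing_maps_inj(1)[OF g] A])
  also have "\<dots> = m A (F \<circ> \<tau>\<^sub>1)"
    using sum_marginal[OF finite_V finite_W A order_refl, of P "F \<circ> \<tau>\<^sub>1"] by simp
  finally show ?thesis .
qed

lemma marginal_reflected_right:
  assumes C: "C \<subseteq> L"
  shows "m' (\<tau>\<^sub>2 ` C) F = m C (F \<circ> \<tau>\<^sub>2)"
proof -
  have eq: "\<tau>\<^sub>1 ` X \<union> \<tau>\<^sub>2 ` L = \<tau>\<^sub>2 ` L"
    using gluing_maps_image_eq[OF g L X order_refl] X by auto
  have "m' (\<tau>\<^sub>2 ` L) G = m L (restrict (G \<circ> \<tau>\<^sub>2) L)" for G
  proof -
    have "m' (\<tau>\<^sub>2 ` L) G = m X (G \<circ> \<tau>\<^sub>1) * m L (G \<circ> \<tau>\<^sub>2) / m X (G \<circ> \<tau>\<^sub>1)"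
      using marginal_reflected[of X L G] X L unfolding eq by simp
    also have "m X (G \<circ> \<tau>\<^sub>1) = m X (G \<circ> \<tau>\<^sub>2)"
      using gluing_maps_eq_iff[OF g] X L by (intro marginal_cong) (force simp: comp_def)
    also have "m X (G \<circ> \<tau>\<^sub>2) * m L (G \<circ> \<tau>\<^sub>2) / m X (G \<circ> \<tau>\<^sub>2) = m L (G \<circ> \<tau>\<^sub>2)"
      using marginal_eq_0[of X L "G \<circ> \<tau>\<^sub>2"] X by auto
    also have "\<dots> = m L (restrict (G \<circ> \<tau>\<^sub>2) L)" by (rule marginal_cong) simp
    finally show ?thesis .
  qed
  then have "m' (\<tau>\<^sub>2 ` C) F = (\<Sum>G | G \<in> \<tau>\<^sub>2 ` L \<rightarrow>\<^sub>E W \<and> (\<forall>v\<in>\<tau>\<^sub>2 ` C. G v = F v).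
      m L (restrict (G \<circ> \<tau>\<^sub>2) L))"
    using sum_marginal[OF finite_reflected finite_W, of "\<tau>\<^sub>2 ` C" "\<tau>\<^sub>2 ` L" "reflected \<tau>\<^sub>1 \<tau>\<^sub>2 L X" F] C
    by (simp add: image_mono)
  also have "\<dots> = (\<Sum>f | f \<in> L \<rightarrow>\<^sub>E W \<and> (\<forall>v\<in>C. f v = F (\<tau>\<^sub>2 v)). m L f)"
    by (rule sum_PiE_image[OF gluing_maps_inj(2)[OF g] C])
  also have "\<dots> = m C (F \<circ> \<tau>\<^sub>2)"
    using sum_marginal[OF finite_V finite_W C L, of P "F \<circ> \<tau>\<^sub>2"] by simp
  finally show ?thesis .
qed

lemma joint_distribution_reflected:
  "joint_distribution (\<tau>\<^sub>1 ` V \<union> \<tau>\<^sub>2 ` L) W (reflected \<tau>\<^sub>1 \<tau>\<^sub>2 L X)"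
proof
  fix F assume F: "F \<in> \<tau>\<^sub>1 ` V \<union> \<tau>\<^sub>2 ` L \<rightarrow>\<^sub>E W"
  have "restrict (F \<circ> \<tau>\<^sub>1) V \<in> V \<rightarrow>\<^sub>E W"
    by (auto intro!: PiE_mem[OF F])
  then show "0 \<le> reflected \<tau>\<^sub>1 \<tau>\<^sub>2 L X F"
    using P_nonneg marginal_nonneg by (simp add: reflected_def)
next
  \<comment> \<open>The total mass is the marginal on the empty set, which the first copy
    preserves.\<close>
  have "m' (\<tau>\<^sub>1 ` {}) undefined = 1"
    by (subst marginal_reflected_left) (simp_all add: marginal_empty)
  then show "(\<Sum>F\<in>\<tau>\<^sub>1 ` V \<union> \<tau>\<^sub>2 ` L \<rightarrow>\<^sub>E W. reflected \<tau>\<^sub>1 \<tau>\<^sub>2 L X F) = 1"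
    by (simp add: marginal_def)
qed (fact finite_reflected finite_W)+

text \<open>The product formula with the denominator cleared; the two halves meet in the image of
  \<open>X\<close>, and a zero of \<open>m X\<close> is also a zero of \<open>m A\<close>.\<close>

lemma marginal_reflected_independent:
  assumes A: "X \<subseteq> A" "A \<subseteq> V" and C: "X \<subseteq> C" "C \<subseteq> L"
  shows "m' (\<tau>\<^sub>1 ` A \<union> \<tau>\<^sub>2 ` C) F * m' (\<tau>\<^sub>1 ` A \<inter> \<tau>\<^sub>2 ` C) F = m' (\<tau>\<^sub>1 ` A) F * m' (\<tau>\<^sub>2 ` C) F"
proof -
  have "m' (\<tau>\<^sub>1 ` A \<inter> \<tau>\<^sub>2 ` C) F = m X (F \<circ> \<tau>\<^sub>1)"
    using gluing_maps_image_Int[OF g L A(2) C(2) A(1) C(1)] marginal_reflected_left[of X] X L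
    by simp
  then show ?thesis
    using marginal_eq_0[OF A(1), of "F \<circ> \<tau>\<^sub>1"]
    by (simp add: marginal_reflected[OF A C] marginal_reflected_left[OF A(2)]
        marginal_reflected_right[OF C(2)])
qed

end

end

subsection \<open>Random homomorphisms from reflection complexes\<close>

text \<open>The invariant of the induction: each frame edge is a uniformly random ordered edge of
  \<open>G\<close>, and related sets are conditionally independent given their intersection, in
  product form to avoid division.\<close>

definition adapted :: "nat \<Rightarrow> 'b hypergraph \<Rightarrow> 'v b_hypergraph \<Rightarrow> (('v \<Rightarrow> 'b) \<Rightarrow> real) \<Rightarrow> bool" where
  "adapted k G M P \<longleftrightarrow> joint_distribution (bverts M) (hverts G) P
    \<and> (\<forall>e\<in>hedges (frame k M). \<forall>f\<in>e \<rightarrow> hverts G. marginal (bverts M) (hverts G) P e f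
        = (if f ` e \<in> hedges G then 1 / real (card (homs (single_edge k) G)) else 0))
    \<and> (\<forall>A C f. (A, C) \<in> brel M \<longrightarrow>
        marginal (bverts M) (hverts G) P (A \<union> C) f * marginal (bverts M) (hverts G) P (A \<inter> C) f
        = marginal (bverts M) (hverts G) P A f * marginal (bverts M) (hverts G) P C f)"

lemma finite_homs:
  assumes "finite (hverts H)" "finite (hverts G)"
  shows "finite (homs H G)"
  using finite_PiE[OF assms(1), of "\<lambda>_. hverts G"] assms(2)
  by (auto simp: homs_def intro: finite_subset)

lemma ex_adapted:
  assumes "M \<in> reflection_complexes k" and G: "k_uniform k G" "homs (single_edge k) G \<noteq> {}"
  shows "\<exists>P. adapted k G M P"
  using assms(1)
proof induction
  case trivial
  define h where "h = homs (single_edge k) G"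
  \<comment> \<open>The uniform distribution on ordered edges of \<open>G\<close>.\<close>
  define P where "P f = (if f \<in> h then 1 / real (card h) else 0)" for f
  have h: "h = {f \<in> {1..k} \<rightarrow>\<^sub>E hverts G. f ` {1..k} \<in> hedges G}"
    by (simp add: h_def homs_def single_edge_def)
  have finG: "finite (hverts G)" using G(1) by (simp add: k_uniform_def)
  then have finh: "finite h" unfolding h_def by (intro finite_homs) (simp_all add: single_edge_def)
  have "(\<Sum>f\<in>{1..k} \<rightarrow>\<^sub>E hverts G. P f) = 1"
  proof -
    have "h \<subseteq> {1..k} \<rightarrow>\<^sub>E hverts G" by (auto simp: h)
    then have "(\<Sum>f\<in>{1..k} \<rightarrow>\<^sub>E hverts G. P f) = (\<Sum>f\<in>h. 1 / real (card h))"
      unfolding P_def using finG by (simp add: sum.If_cases finite_PiE Int_absorb1)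
    then show ?thesis using finh G(2) by (simp add: h_def)
  qed
  then have "joint_distribution {1..k} (hverts G) P"
    using finG by unfold_locales (auto simp: P_def)
  note jd = this
  moreover have "marginal {1..k} (hverts G) P {1..k} f
      = (if f ` {1..k} \<in> hedges G then 1 / real (card h) else 0)" if f: "f \<in> {1..k} \<rightarrow> hverts G" for f
  proof -
    have fE: "restrict f {1..k} \<in> {1..k} \<rightarrow>\<^sub>E hverts G" using f by auto
    have "marginal {1..k} (hverts G) P {1..k} f = marginal {1..k} (hverts G) P {1..k} (restrict f {1..k})"
      by (rule marginal_cong) simp
    also have "\<dots> = P (restrict f {1..k})"
      by (rule joint_distribution.marginal_full[OF jd fE])
    finally show ?thesis using fE by (simp add: P_def h)
  qed
  moreover have "hedges (frame k (trivial_complex k)) = {{1..k}}"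
    by (auto simp: frame_def trivial_complex_def)
  ultimately have "adapted k G (trivial_complex k) P"
    by (simp add: adapted_def trivial_complex_def h_def[symmetric])
  then show ?case by blast
next
  case (reflect M L X M')
  define V where "V = bverts M"
  define W where "W = hverts G"
  from reflect obtain \<tau>\<^sub>1 \<tau>\<^sub>2 where L: "L \<in> bedges M" and X: "X \<subseteq> L"
    and g: "gluing_maps V L X \<tau>\<^sub>1 \<tau>\<^sub>2" and M': "M' = reflection \<tau>\<^sub>1 \<tau>\<^sub>2 M L X"
    by (auto simp: is_reflection_def V_def)
  note M = reflect.hyps(1)
  have b: "bedges M \<subseteq> Pow V" "brel M \<subseteq> Pow V \<times> Pow V"
    using is_b_hypergraph_reflection_complex[OF M] by (auto simp: is_b_hypergraph_def V_def)
  have LV: "L \<subseteq> V" using L b by auto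
  obtain P where "adapted k G M P" using reflect.IH ..
  then interpret joint_distribution V W P
    by (simp add: adapted_def V_def W_def)
  have edge: "m e f = (if f ` e \<in> hedges G then 1 / real (card (homs (single_edge k) G)) else 0)"
    if "e \<in> hedges (frame k M)" "f \<in> e \<rightarrow> W" for e f
    using \<open>adapted k G M P\<close> that by (simp add: adapted_def V_def W_def)
  have ind: "m (A \<union> C) f * m (A \<inter> C) f = m A f * m C f" if "(A, C) \<in> brel M" for A C f
    using \<open>adapted k G M P\<close> that by (simp add: adapted_def V_def W_def)
  let ?P = "reflected \<tau>\<^sub>1 \<tau>\<^sub>2 L X"
  let ?m = "marginal (\<tau>\<^sub>1 ` V \<union> \<tau>\<^sub>2 ` L) W ?P"
  note left = marginal_reflected_left[OF g LV X]
  note right = marginal_reflected_right[OF g LV X]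
  have V': "bverts M' = \<tau>\<^sub>1 ` V \<union> \<tau>\<^sub>2 ` L" by (simp add: M' reflection_def V_def)
  have "?m e f = (if f ` e \<in> hedges G then 1 / real (card (homs (single_edge k) G)) else 0)"
    if e: "e \<in> hedges (frame k M')" and f: "f \<in> e \<rightarrow> W" for e f
  proof -
    \<comment> \<open>Every frame edge lies in one of the two copies, each of which inherits the
      marginals of \<open>P\<close>.\<close>
    from e consider d where "e = \<tau>\<^sub>1 ` d" "d \<in> hedges (frame k M)"
      | d where "e = \<tau>\<^sub>2 ` d" "d \<in> hedges (frame k M)" "d \<subseteq> L"
      unfolding M' hedges_frame_reflection[OF M L g[unfolded V_def]] by blast
    then show ?thesis
    proof cases
      case 1
      moreover have "d \<subseteq> V" using 1 b by (auto simp: frame_def)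
      moreover have "f \<circ> \<tau>\<^sub>1 \<in> d \<rightarrow> W" using f 1 by auto
      ultimately show ?thesis by (simp add: left edge image_comp)
    next
      case 2
      moreover have "f \<circ> \<tau>\<^sub>2 \<in> d \<rightarrow> W" using f 2 by auto
      ultimately show ?thesis by (simp add: right edge image_comp)
    qed
  qed
  moreover have "?m (S \<union> T) f * ?m (S \<inter> T) f = ?m S f * ?m T f" if "(S, T) \<in> brel M'" for S T f
  proof -
    \<comment> \<open>Copied pairs inherit independence from \<open>P\<close>; the new cross pairs
      get it from the gluing.\<close>
    from that consider
        (1) A C where "S = \<tau>\<^sub>1 ` A" "T = \<tau>\<^sub>1 ` C" "(A, C) \<in> brel M"
      | (2) A C where "S = \<tau>\<^sub>2 ` A" "T = \<tau>\<^sub>2 ` C" "(A, C) \<in> brel M" "A \<subseteq> L" "C \<subseteq> L"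
      | (3) K\<^sub>1 K\<^sub>2 where "S = \<tau>\<^sub>1 ` K\<^sub>1" "T = \<tau>\<^sub>2 ` K\<^sub>2"
          "K\<^sub>1 \<in> bedges M" "K\<^sub>2 \<subseteq> L" "X \<subseteq> K\<^sub>1" "X \<subseteq> K\<^sub>2"
      | (4) K\<^sub>1 K\<^sub>2 where "T = \<tau>\<^sub>1 ` K\<^sub>1" "S = \<tau>\<^sub>2 ` K\<^sub>2"
          "K\<^sub>1 \<in> bedges M" "K\<^sub>2 \<subseteq> L" "X \<subseteq> K\<^sub>1" "X \<subseteq> K\<^sub>2"
      unfolding M' reflection_def by auto
    then show ?thesis
    proof cases
      case 1
      then have AC: "A \<subseteq> V" "C \<subseteq> V" "A \<union> C \<subseteq> V" "A \<inter> C \<subseteq> V" using b by auto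
      have "S \<union> T = \<tau>\<^sub>1 ` (A \<union> C)" "S \<inter> T = \<tau>\<^sub>1 ` (A \<inter> C)"
        using 1 AC by (simp_all add: image_Un inj_on_image_Int[OF gluing_maps_inj(1)[OF g]])
      then show ?thesis using 1 AC by (simp only: left ind)
    next
      case 2
      then have AC: "A \<union> C \<subseteq> L" "A \<inter> C \<subseteq> L" by auto
      have "S \<union> T = \<tau>\<^sub>2 ` (A \<union> C)" "S \<inter> T = \<tau>\<^sub>2 ` (A \<inter> C)"
        using 2 by (simp_all add: image_Un inj_on_image_Int[OF gluing_maps_inj(2)[OF g]])
      then show ?thesis using 2 AC by (simp only: right ind)
    next
      case 3
      then show ?thesis using b marginal_reflected_independent[OF g LV X, of K\<^sub>1 K\<^sub>2 f] by auto
    next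
      case 4
      then show ?thesis using b marginal_reflected_independent[OF g LV X, of K\<^sub>1 K\<^sub>2 f]
        by (auto simp: Un_commute Int_commute mult.commute)
    qed
  qed
  ultimately have "adapted k G M' ?P"
    using joint_distribution_reflected[OF g LV X]
    unfolding adapted_def V' W_def[symmetric] by blast
  then show ?case by blast
qed

section \<open>From weak thickness to Sidorenko's inequality\<close>

lemma frame_edges_nonempty:
  "M \<in> reflection_complexes k \<Longrightarrow> hedges (frame k M) \<noteq> {}"
proof (induction rule: reflection_complexes.induct)
  case trivial
  show ?case by (auto simp: frame_def trivial_complex_def)
next
  case (reflect M L X M')
  then show ?case by (auto simp: is_reflection_def hedges_frame_reflection)
qed

lemma hom_density_eq:
  "finite (hverts H) \<Longrightarrow>
    hom_density H G = real (card (homs H G)) / real (card (hverts G)) ^ card (hverts H)"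
  by (simp add: hom_density_def card_funcsetE)

lemma weakly_thick_sidorenko:
  assumes "weakly_thick k H" and G: "k_uniform k G"
  shows "hom_density (single_edge k) G ^ card (hedges H) \<le> hom_density H G"
proof -
  obtain M where M: "M \<in> reflection_complexes k" and H: "frame k M = H"
    and thick: "weakly_thick_complex k M"
    using assms(1) by (auto simp: weakly_thick_def)
  define V where "V = bverts M"
  define W where "W = hverts G"
  define N where "N = real (card (homs (single_edge k) G))"
  define n where "n = real (card W)"
  have b: "finite V" "bedges M \<subseteq> Pow V" "brel M \<subseteq> Pow V \<times> Pow V"
    using is_b_hypergraph_reflection_complex[OF M] by (auto simp: is_b_hypergraph_def V_def)
  have HV: "hverts H = V" "hedges H \<subseteq> Pow V" and card_e: "\<And>e. e \<in> hedges H \<Longrightarrow> card e = k"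
    using b by (auto simp: H[symmetric] frame_def V_def)
  have "finite (hedges H)" using HV(2) b(1) by (auto intro: finite_subset)
  then have E0: "0 < card (hedges H)"
    using frame_edges_nonempty[OF M] H by (simp add: card_gt_0_iff)
  have t1: "hom_density (single_edge k) G = N / n ^ k"
    by (simp add: hom_density_eq single_edge_def N_def n_def W_def)
  have tH: "hom_density H G = real (card (homs H G)) / n ^ card V"
    using b(1) HV by (simp add: hom_density_eq n_def W_def)
  have finW: "finite W" using G by (simp add: k_uniform_def W_def)
  show ?thesis
  \<comment> \<open>Without edge homomorphisms the left side is a power of 0; it vanishes because
    \<open>H\<close> has an edge, so that the exponent is positive.\<close>
  proof (cases "homs (single_edge k) G = {}")
    case True
    then show ?thesis using E0 t1 by (simp add: N_def hom_density_def zero_power)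
  next
    case False
    have N: "0 < N"
      using False finite_homs[of "single_edge k" G] finW
      by (simp add: N_def card_gt_0_iff single_edge_def W_def)
    obtain P where P: "adapted k G M P" using ex_adapted[OF M G False] ..
    interpret joint_distribution V W P
      using P by (simp add: adapted_def V_def W_def)
    have edge: "m e f = (if f ` e \<in> hedges G then 1 / N else 0)"
      if "e \<in> hedges H" "f \<in> e \<rightarrow> W" for e f
      using P that by (simp add: adapted_def V_def W_def H N_def)
    have ind: "m (A \<union> C) f * m (A \<inter> C) f = m A f * m C f" if "(A, C) \<in> brel M" for A C f
      using P that by (simp add: adapted_def V_def W_def)
    \<comment> \<open>A map of positive weight has positive marginals, and an edge marginal takes
      only the values \<open>1 / N\<close> and 0, so such a map sends each frame edge to an edge of
      \<open>G\<close>.\<close>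
    have supp: "m e f = 1 / N" "f ` e \<in> hedges G"
      if "e \<in> hedges H" "f \<in> V \<rightarrow>\<^sub>E W" "0 < P f" for e f
    proof -
      have "e \<subseteq> V" using that(1) HV by auto
      then have "f \<in> e \<rightarrow> W" "0 < m e f" using that marginal_pos by auto
      then show "m e f = 1 / N" "f ` e \<in> hedges G"
        using edge[OF that(1), of f] by (auto split: if_splits)
    qed
    have ent_e: "rel_entropy e = ln (n ^ k / N)" if e: "e \<in> hedges H" for e
    proof -
      have "P f * ln (n ^ k * m e f) = P f * ln (n ^ k / N)" if "f \<in> V \<rightarrow>\<^sub>E W" for f
        using supp(1)[OF e that] P_nonneg[OF that] by (cases "P f = 0") auto
      then have "rel_entropy e = (\<Sum>f\<in>V \<rightarrow>\<^sub>E W. P f * ln (n ^ k / N))"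
        unfolding rel_entropy_def card_e[OF e] n_def[symmetric] by (intro sum.cong refl)
      then show ?thesis
        using sum_P by (simp flip: sum_distrib_right)
    qed
    \<comment> \<open>So \<open>P\<close> is supported on homomorphisms, and the entropy bound
      applies with \<open>T = homs H G\<close>.\<close>
    have "f \<in> homs H G" if "f \<in> V \<rightarrow>\<^sub>E W" "0 < P f" for f
      using supp(2)[OF _ that] that(1) HV by (auto simp: homs_def W_def)
    then have hom: "0 < card (homs H G)" "ln (n ^ card V / real (card (homs H G))) \<le> rel_entropy V"
      using rel_entropy_support[of "homs H G"] HV by (auto simp: homs_def n_def W_def)
    obtain w q where "svec H = w + q" "w \<in> W_space (brel M)" "q \<in> Q_cone V"
      using thick by (auto simp: weakly_thick_complex_def H V_def)
    then have "rel_entropy V \<le> (\<Sum>e\<in>hedges H. rel_entropy e)"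
      using ind by (intro rel_entropy_weakly_thick[OF b(3) _ _ _ _ HV])
    also have "\<dots> = real (card (hedges H)) * ln (n ^ k / N)"
      by (simp add: ent_e)
    also have "\<dots> = ln ((n ^ k / N) ^ card (hedges H))"
      using card_power_pos N E0 HV card_e by (simp add: ln_realpow)
    finally have "ln (n ^ card V / real (card (homs H G))) \<le> ln ((n ^ k / N) ^ card (hedges H))"
      using hom(2) by simp
    moreover have nV: "0 < n ^ card V"
      using card_power_pos[OF order_refl] by (simp add: n_def)
    moreover have nk: "0 < n ^ k"
    proof -
      obtain e where "e \<in> hedges H" using E0 by fastforce
      then show ?thesis using card_power_pos[of e] HV card_e by (auto simp: n_def)
    qed
    ultimately have "n ^ card V / real (card (homs H G)) \<le> (n ^ k / N) ^ card (hedges H)"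
      using hom(1) N by simp
    \<comment> \<open>Reciprocals turn the comparison back into one between densities.\<close>
    then have "inverse ((n ^ k / N) ^ card (hedges H)) \<le> inverse (n ^ card V / real (card (homs H G)))"
      using hom(1) nV by (intro le_imp_inverse_le) auto
    then show ?thesis by (simp add: t1 tH power_divide)
  qed
qed

theorem theorem9p3:
  fixes k :: nat and H :: "nat hypergraph"
  assumes "H \<in> R_hypergraphs k"
  shows "weakly_thick k H
    \<and> (\<forall>G :: 'b hypergraph. k_uniform k G \<longrightarrow>
          hom_density H G \<ge> hom_density (single_edge k) G ^ card (hedges H))"
proof -
  obtain M where "M \<in> C_complexes k" "frame k M = H"
    using assms by (auto simp: R_hypergraphs_def)
  then have "weakly_thick k H"
    using C_complex_weakly_thick C_complex_imp_reflection_complex by (auto simp: weakly_thick_def)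
  then show ?thesis using weakly_thick_sidorenko by blast
qed

end
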